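(* Let $n>1$ be an integer. Let $g_{II}$ be Stenzel's complete Ricci-flat Kähler metric on the complexification $M_{II}^{2n}$ of $\mathbb{C}\mathrm{P}^n$, and let $g_{III}$ be Stenzel's complete Ricci-flat Kähler metric on the complexification $M_{III}^{4n}$ of $\mathbb{H}\mathrm{P}^n$ (both defined explicitly in the context). Then neither $(M_{II}^{2n},g_{II})$ nor $(M_{III}^{4n},g_{III})$ is projectively induced. Moreover, for every real constant $c$ with $0<c\le 1$, neither $(M_{II}^{2n},c\,g_{II})$ nor $(M_{III}^{4n},c\,g_{III})$ is projectively induced.
   Context: **Kähler potentials.** A Kähler potential for a Kähler metric $g$ on an open set with holomorphic coordinates $(x_1,\dots,x_m)$ is a real-valued function $\varphi$ with $g_{j\bar k}=\frac{\partial^2\varphi}{\partial x_j\partial\bar x_k}$. **Projectively induced metrics.** For $N\le\infty$, $\mathbb{C}\mathrm{P}^N$ denotes the complex projective space of dimension $N$ (for $N=\infty$, the projectivization of $\ell^2(\mathbb{C})$), with homogeneous coordinates $[Z_0,Z_1,\dots]$ and the Fubini–Study metric $g_{FS}$. On $\{Z_0\neq 0\}$, with affine coordinates $\zeta_j=Z_j/Z_0$, a Kähler potential for $g_{FS}$ is $\log\left(1+\sum_{j=1}^N|\zeta_j|^2\right)$, and similarly on the other affine charts. A Kähler metric $g$ on a complex manifold $M$ is projectively induced if there exist $N\le\infty$ and a holomorphic map $F:M\to\mathbb{C}\mathrm{P}^N$ with $F^*g_{FS}=g$. **The metric $g_{II}$.** Let $(z,w)=(z_0,\dots,z_n,w_0,\dots,w_n)$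 be homogeneous coordinates on $\mathbb{C}\mathrm{P}^n\times\mathbb{C}\mathrm{P}^n$ and put $$M_{II}^{2n}=\left(\mathbb{C}\mathrm{P}^n\times\mathbb{C}\mathrm{P}^n\right)\setminus\Big\{(z,w):\ \sum_{j=0}^n z_jw_j=0\Big\}.$$ Define $\mathcal N:M_{II}^{2n}\to[1,\infty)$ by $$\mathcal N=\frac{\left(\sum_{j=0}^n|z_j|^2\right)\left(\sum_{j=0}^n|w_j|^2\right)}{\left|\sum_{j=0}^nz_jw_j\right|^2}.$$ In affine coordinates $z_0=w_0=1$ this is $$\mathcal N=\frac{\left(1+\sum_{j=1}^n|z_j|^2\right)\left(1+\sum_{j=1}^n|w_j|^2\right)}{\left|1+\sum_{j=1}^nz_jw_j\right|^2}.$$ The metric $g_{II}$ is the Kähler metric with Kähler potential $f(\mathcal N)$, where $f:[1,\infty)\to\mathbb{R}$ is the smooth solution, with $f'(1)=1$, of $$(2\mathcal N-1)\mathcal N^{n-1}(f')^{2n}+2(\mathcal N-1)\mathcal N^n(f')^{2n-1}f''=1.$$ Explicitly, $f'(\mathcal N)=\mathcal N^{-1/2}$. The additive constant in $f$ does not affect the metric. **The metric $g_{III}$.** Let $\mathrm{Gr}(2,2n+2,\mathbb{C})$ be the Grassmannian of complex $2$-planes through the origin in $\mathbb{C}^{2n+2}$. A plane is represented by a basis $z=(z_1,\dots,z_{2n+2})$, $w=(w_1,\dots,w_{2n+2})$. Put $$M_{III}^{4n}=\mathrm{Gr}(2,2n+2,\mathbb{C})\setminus\Big\{(z,w):\ \sum_{j=1}^{n+1}\left(z_{2j}w_{2j-1}-z_{2j-1}w_{2j}\right)=0\Big\}.$$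 Define $\mathcal N:M_{III}^{4n}\to[1,\infty)$ (independently of the basis chosen) by $$\mathcal N=\frac{\left(\sum_{j=1}^{2n+2}|z_j|^2\right)\left(\sum_{j=1}^{2n+2}|w_j|^2\right)-\left|\sum_{j=1}^{2n+2}z_j\bar w_j\right|^2}{\left|\sum_{j=1}^{n+1}\left(z_{2j}w_{2j-1}-z_{2j-1}w_{2j}\right)\right|^2}.$$ In the inhomogeneous coordinates given by the basis $(z_1,\dots,z_{2n},1,0)$, $(w_1,\dots,w_{2n},0,1)$, with $\|z\|^2=\sum_{j=1}^{2n}|z_j|^2$ and $\|w\|^2=\sum_{j=1}^{2n}|w_j|^2$, this is $$\mathcal N=\frac{(1+\|z\|^2)(1+\|w\|^2)-\sum_{j,k=1}^{2n}z_j\bar w_j\bar z_kw_k}{\left|\sum_{j=1}^{n}\left(z_{2j}w_{2j-1}-z_{2j-1}w_{2j}\right)-1\right|^2}.$$ The metric $g_{III}$ is the Kähler metric with Kähler potential $f(\mathcal N)$, where $f:[1,\infty)\to\mathbb{R}$ is the smooth solution, with $f(1)=0$ and $f'(1)=1$, of $$(2\mathcal N-1)\mathcal N^{2n-2}(f')^{4n}+2(\mathcal N-1)\mathcal N^{2n-1}(f')^{4n-1}f''=1.$$ *)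

theory Defs
  imports "HOL-Analysis.Analysis"
begin

section \<open>The Hilbert space of square-summable complex sequences\<close>

typedef ell2 = "{x :: nat \<Rightarrow> complex. summable (\<lambda>j. (cmod (x j))\<^sup>2)}"
  morphisms ell2_nth Abs_ell2
  by (rule exI[of _ "\<lambda>_. 0"]) simp

setup_lifting type_definition_ell2

lemma ell2_summable: "summable (\<lambda>j. (cmod (ell2_nth x j))\<^sup>2)"
  using ell2_nth by blast

lemma ell2_eqI: "(\<And>j. ell2_nth x j = ell2_nth y j) \<Longrightarrow> x = y"
  by (metis ell2_nth_inject ext)

lemma square_summable_scale:
  fixes x :: "nat \<Rightarrow> complex"
  assumes "summable (\<lambda>j. (cmod (x j))\<^sup>2)"
  shows "summable (\<lambda>j. (cmod (c * x j))\<^sup>2)"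
  using summable_mult[OF assms, of "(cmod c)\<^sup>2"] by (simp add: norm_mult power_mult_distrib)

lemma square_summable_add:
  fixes x y :: "nat \<Rightarrow> complex"
  assumes "summable (\<lambda>j. (cmod (x j))\<^sup>2)" "summable (\<lambda>j. (cmod (y j))\<^sup>2)"
  shows "summable (\<lambda>j. (cmod (x j + y j))\<^sup>2)"
proof (rule summable_comparison_test')
  show "summable (\<lambda>j. 2 * (cmod (x j))\<^sup>2 + 2 * (cmod (y j))\<^sup>2)"
    by (intro summable_add summable_mult assms)
  fix j
  have "(cmod (x j + y j))\<^sup>2 \<le> (cmod (x j) + cmod (y j))\<^sup>2"
    by (intro power_mono norm_triangle_ineq) auto
  also have "\<dots> \<le> 2 * (cmod (x j))\<^sup>2 + 2 * (cmod (y j))\<^sup>2"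
    using sum_squares_bound[of "cmod (x j)" "cmod (y j)"] by (simp add: power2_sum)
  finally show "norm ((cmod (x j + y j))\<^sup>2) \<le> 2 * (cmod (x j))\<^sup>2 + 2 * (cmod (y j))\<^sup>2"
    by simp
qed

lemma square_summable_inner:
  fixes x y :: "nat \<Rightarrow> complex"
  assumes "summable (\<lambda>j. (cmod (x j))\<^sup>2)" "summable (\<lambda>j. (cmod (y j))\<^sup>2)"
  shows "summable (\<lambda>j. x j \<bullet> y j)"
proof (rule summable_comparison_test')
  show "summable (\<lambda>j. (cmod (x j))\<^sup>2 + (cmod (y j))\<^sup>2)"
    by (intro summable_add assms)
  fix j
  have "norm (x j \<bullet> y j) \<le> cmod (x j) * cmod (y j)"
    by (simp add: Cauchy_Schwarz_ineq2)
  also have "\<dots> \<le> 2 * (cmod (x j) * cmod (y j))" by simp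
  also have "\<dots> \<le> (cmod (x j))\<^sup>2 + (cmod (y j))\<^sup>2"
    using sum_squares_bound[of "cmod (x j)" "cmod (y j)"] by (simp add: mult.assoc)
  finally show "norm (x j \<bullet> y j) \<le> (cmod (x j))\<^sup>2 + (cmod (y j))\<^sup>2" .
qed

lift_definition ell2_scale :: "complex \<Rightarrow> ell2 \<Rightarrow> ell2" is "\<lambda>c x j. c * x j"
  by (simp add: square_summable_scale)

instantiation ell2 :: real_vector
begin

lift_definition zero_ell2 :: ell2 is "\<lambda>_. 0" by simp

lift_definition plus_ell2 :: "ell2 \<Rightarrow> ell2 \<Rightarrow> ell2" is "\<lambda>x y j. x j + y j"
  by (simp add: square_summable_add)

lift_definition uminus_ell2 :: "ell2 \<Rightarrow> ell2" is "\<lambda>x j. - x j" by simp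

definition minus_ell2 :: "ell2 \<Rightarrow> ell2 \<Rightarrow> ell2" where "minus_ell2 x y = x + - y"

definition scaleR_ell2 :: "real \<Rightarrow> ell2 \<Rightarrow> ell2"
  where "scaleR_ell2 r x = ell2_scale (of_real r) x"

instance
proof
  note nth = plus_ell2.rep_eq zero_ell2.rep_eq uminus_ell2.rep_eq ell2_scale.rep_eq
  fix x y z :: ell2 and a b :: real
  show "x + y + z = x + (y + z)" "x + y = y + x" "0 + x = x" "- x + x = 0"
    by (rule ell2_eqI, simp add: nth)+
  show "x - y = x + - y" by (rule minus_ell2_def)
  show "a *\<^sub>R (x + y) = a *\<^sub>R x + a *\<^sub>R y" "(a + b) *\<^sub>R x = a *\<^sub>R x + b *\<^sub>R x"
    "a *\<^sub>R b *\<^sub>R x = (a * b) *\<^sub>R x" "1 *\<^sub>R x = x"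
    by (rule ell2_eqI, simp add: nth scaleR_ell2_def algebra_simps)+
qed

end

instantiation ell2 :: real_inner
begin

definition inner_ell2 :: "ell2 \<Rightarrow> ell2 \<Rightarrow> real"
  where "inner_ell2 x y = (\<Sum>j. ell2_nth x j \<bullet> ell2_nth y j)"

definition norm_ell2 :: "ell2 \<Rightarrow> real" where "norm_ell2 x = sqrt (x \<bullet> x)"

definition sgn_ell2 :: "ell2 \<Rightarrow> ell2" where "sgn_ell2 x = x /\<^sub>R norm x"

definition dist_ell2 :: "ell2 \<Rightarrow> ell2 \<Rightarrow> real" where "dist_ell2 x y = norm (x - y)"

definition uniformity_ell2 :: "(ell2 \<times> ell2) filter"
  where "uniformity_ell2 = (INF e\<in>{0<..}. principal {(x, y). dist x y < e})"

definition open_ell2 :: "ell2 set \<Rightarrow> bool"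
  where "open_ell2 U \<longleftrightarrow> (\<forall>x\<in>U. eventually (\<lambda>(x', y). x' = x \<longrightarrow> y \<in> U) uniformity)"

instance
proof
  note nth = plus_ell2.rep_eq zero_ell2.rep_eq ell2_scale.rep_eq
  fix x y z :: ell2 and a :: real and U :: "ell2 set"
  show "sgn x = x /\<^sub>R norm x" by (rule sgn_ell2_def)
  show "dist x y = norm (x - y)" by (rule dist_ell2_def)
  show "(uniformity :: (ell2 \<times> ell2) filter) = (INF e\<in>{0<..}. principal {(x, y). dist x y < e})"
    by (rule uniformity_ell2_def)
  show "open U = (\<forall>x\<in>U. eventually (\<lambda>(x', y). x' = x \<longrightarrow> y \<in> U) uniformity)"
    by (rule open_ell2_def)
  show "norm x = sqrt (x \<bullet> x)" by (rule norm_ell2_def)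
  have sm: "summable (\<lambda>j. ell2_nth u j \<bullet> ell2_nth v j)" for u v
    by (intro square_summable_inner ell2_summable)
  show "x \<bullet> y = y \<bullet> x" by (simp add: inner_ell2_def inner_commute)
  show "(x + y) \<bullet> z = x \<bullet> z + y \<bullet> z"
    by (simp add: inner_ell2_def nth inner_add_left suminf_add[OF sm sm])
  have sc: "ell2_nth (a *\<^sub>R x) j = a *\<^sub>R ell2_nth x j" for j
    by (simp add: scaleR_ell2_def nth scaleR_conv_of_real)
  show "(a *\<^sub>R x) \<bullet> y = a * (x \<bullet> y)"
    by (simp add: inner_ell2_def sc suminf_mult[OF sm])
  show "0 \<le> x \<bullet> x" by (simp add: inner_ell2_def suminf_nonneg[OF sm])
  show "(x \<bullet> x = 0) = (x = 0)"
  proof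
    assume "x \<bullet> x = 0"
    then have "\<forall>j. ell2_nth x j \<bullet> ell2_nth x j = 0"
      using suminf_eq_zero_iff[OF sm[of x x]] by (simp add: inner_ell2_def)
    then show "x = 0" by (intro ell2_eqI) (simp add: nth)
  qed (simp add: inner_ell2_def nth)
qed

end

lemma norm_ell2_power2: "(norm x)\<^sup>2 = (\<Sum>j. (cmod (ell2_nth x j))\<^sup>2)" for x :: ell2
  by (simp add: power2_norm_eq_inner inner_ell2_def)


section \<open>Wirtinger derivatives\<close>

definition wirtinger :: "(complex \<Rightarrow> complex) \<Rightarrow> complex \<Rightarrow> complex" where
  "wirtinger h s =
     (vector_derivative (\<lambda>t::real. h (s + of_real t)) (at 0)
       - \<i> * vector_derivative (\<lambda>t::real. h (s + \<i> * of_real t)) (at 0)) / 2"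

definition wirtinger_bar :: "(complex \<Rightarrow> complex) \<Rightarrow> complex \<Rightarrow> complex" where
  "wirtinger_bar h s =
     (vector_derivative (\<lambda>t::real. h (s + of_real t)) (at 0)
       + \<i> * vector_derivative (\<lambda>t::real. h (s + \<i> * of_real t)) (at 0)) / 2"

text \<open>
  For a complex vector space with scalar multiplication \<open>scl\<close>, this is the mixed derivative of
  \<open>\<phi>\<close> at \<open>x\<close>, holomorphic along \<open>u\<close> and antiholomorphic along \<open>v\<close>.  For the \<open>j\<close>-th and \<open>k\<close>-th
  coordinate vectors it is \<open>\<partial>\<^sup>2\<phi> / \<partial>x\<^sub>j \<partial>(cnj x\<^sub>k)\<close>.
\<close>

definition complex_hessian ::
    "(complex \<Rightarrow> 'v \<Rightarrow> 'v) \<Rightarrow> ('v::ab_group_add \<Rightarrow> real) \<Rightarrow> 'v \<Rightarrow> 'v \<Rightarrow> 'v \<Rightarrow> complex" where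
  "complex_hessian scl \<phi> x u v =
     wirtinger (\<lambda>s. wirtinger_bar (\<lambda>t. of_real (\<phi> (x + scl s u + scl t v))) 0) 0"


section \<open>Charts and Kaehler metrics\<close>

text \<open>
  A chart is a local parametrization: an open set of \<open>\<complex>\<^sup>m\<close> with a map from it to the manifold.
  A Hermitian metric is given by its matrices \<open>g\<^sub>j\<^sub>k\<close> (second index antiholomorphic) in the charts.
\<close>

type_synonym ('p, 'm) chart = "(complex ^ 'm) set \<times> (complex ^ 'm \<Rightarrow> 'p)"

type_synonym ('p, 'm) hermitian_metric =
  "('p, 'm) chart \<Rightarrow> complex ^ 'm \<Rightarrow> complex ^ 'm ^ 'm"

definition kahler_metric :: "('p \<Rightarrow> real) \<Rightarrow> ('p, 'm::finite) hermitian_metric" where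
  "kahler_metric \<phi> C x =
     (\<chi> j k. complex_hessian (*s) (\<lambda>y. \<phi> (snd C y)) x (axis j 1) (axis k 1))"

definition scale_metric ::
    "real \<Rightarrow> ('p, 'm::finite) hermitian_metric \<Rightarrow> ('p, 'm) hermitian_metric" where
  "scale_metric c g C x = c *\<^sub>R g C x"


section \<open>Complex projective space of finite or infinite dimension\<close>

text \<open>
  Points are complex lines in \<open>\<ell>\<^sup>2\<close>, with homogeneous coordinates \<open>Z\<^sub>0, Z\<^sub>1, \<dots>\<close>; for finite \<open>N\<close>
  the coordinates of index greater than \<open>N\<close> vanish.
\<close>

definition ell2_line :: "ell2 \<Rightarrow> ell2 set" where
  "ell2_line Z = range (\<lambda>c. ell2_scale c Z)"

definition CP :: "enat \<Rightarrow> ell2 set set" where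
  "CP N = {ell2_line Z | Z. Z \<noteq> 0 \<and> (\<forall>j. N < enat j \<longrightarrow> ell2_nth Z j = 0)}"

definition affine_domain :: "nat \<Rightarrow> ell2 set set" where
  "affine_domain a = {L. \<exists>Z\<in>L. ell2_nth Z a \<noteq> 0}"

text \<open>
  The affine coordinates \<open>Z\<^sub>j / Z\<^sub>a\<close> with \<open>j \<noteq> a\<close>; the unused slot \<open>a\<close> is filled with \<open>0\<close>.
\<close>

definition affine_coords :: "nat \<Rightarrow> ell2 set \<Rightarrow> ell2" where
  "affine_coords a L =
     (THE \<zeta>. \<exists>Z\<in>L. ell2_nth Z a \<noteq> 0 \<and>
        (\<forall>j. ell2_nth \<zeta> j = (if j = a then 0 else ell2_nth Z j / ell2_nth Z a)))"

text \<open>The Fubini--Study metric in affine coordinates, from its potential.\<close>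

definition fubini_study :: "ell2 \<Rightarrow> ell2 \<Rightarrow> ell2 \<Rightarrow> complex" where
  "fubini_study = complex_hessian ell2_scale (\<lambda>\<zeta>. ln (1 + (\<Sum>j. (cmod (ell2_nth \<zeta> j))\<^sup>2)))"

definition holomorphic_ell2 :: "(complex ^ 'm::finite \<Rightarrow> ell2) \<Rightarrow> (complex ^ 'm) set \<Rightarrow> bool" where
  "holomorphic_ell2 h V \<longleftrightarrow>
     (\<forall>x\<in>V. \<exists>D. (h has_derivative D) (at x) \<and> (\<forall>c u. D (c *s u) = ell2_scale c (D u)))"

definition holomorphic_to_CP ::
    "enat \<Rightarrow> 'p set \<Rightarrow> ('p, 'm::finite) chart set \<Rightarrow> ('p \<Rightarrow> ell2 set) \<Rightarrow> bool" where
  "holomorphic_to_CP N M A F \<longleftrightarrow>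
     F ` M \<subseteq> CP N \<and>
     (\<forall>(U, \<psi>)\<in>A. \<forall>x\<in>U. \<exists>a V. open V \<and> x \<in> V \<and> V \<subseteq> U \<and>
        (\<forall>y\<in>V. F (\<psi> y) \<in> affine_domain a) \<and>
        holomorphic_ell2 (\<lambda>y. affine_coords a (F (\<psi> y))) V)"

text \<open>The matrix of the pullback of the Fubini--Study metric, computed in the \<open>a\<close>-th affine chart.\<close>

definition pullback_fubini_study ::
    "('p \<Rightarrow> ell2 set) \<Rightarrow> nat \<Rightarrow> ('p, 'm::finite) hermitian_metric" where
  "pullback_fubini_study F a C x =
     (let h = (\<lambda>y. affine_coords a (F (snd C y))); D = frechet_derivative h (at x)
      in \<chi> j k. fubini_study (h x) (D (axis j 1)) (D (axis k 1)))"

definition projectively_induced ::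
    "'p set \<Rightarrow> ('p, 'm::finite) chart set \<Rightarrow> ('p, 'm) hermitian_metric \<Rightarrow> bool" where
  "projectively_induced M A g \<longleftrightarrow>
     (\<exists>(N::enat) F. holomorphic_to_CP N M A F \<and>
        (\<forall>C\<in>A. \<forall>x\<in>fst C. \<forall>a. F (snd C x) \<in> affine_domain a \<longrightarrow>
           pullback_fubini_study F a C x = g C x))"


section \<open>Smooth functions on a closed half-line\<close>

text \<open>The derivative on \<open>[1, \<infinity>)\<close>, one-sided at the end point.\<close>

definition ray_deriv :: "(real \<Rightarrow> real) \<Rightarrow> real \<Rightarrow> real" where
  "ray_deriv f x = vector_derivative f (at x within {1..})"

definition smooth_on_ray :: "(real \<Rightarrow> real) \<Rightarrow> bool" where
  "smooth_on_ray f \<longleftrightarrow> (\<forall>k. \<forall>x\<ge>1. (ray_deriv ^^ k) f differentiable (at x within {1..}))"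

definition profile_II :: "nat \<Rightarrow> (real \<Rightarrow> real) \<Rightarrow> bool" where
  "profile_II n f \<longleftrightarrow>
     smooth_on_ray f \<and> ray_deriv f 1 = 1 \<and>
     (\<forall>x\<ge>1. (2 * x - 1) * x ^ (n - 1) * ray_deriv f x ^ (2 * n)
        + 2 * (x - 1) * x ^ n * ray_deriv f x ^ (2 * n - 1) * ray_deriv (ray_deriv f) x = 1)"

definition profile_III :: "nat \<Rightarrow> (real \<Rightarrow> real) \<Rightarrow> bool" where
  "profile_III n f \<longleftrightarrow>
     smooth_on_ray f \<and> f 1 = 0 \<and> ray_deriv f 1 = 1 \<and>
     (\<forall>x\<ge>1. (2 * x - 1) * x ^ (2 * n - 2) * ray_deriv f x ^ (4 * n)
        + 2 * (x - 1) * x ^ (2 * n - 1) * ray_deriv f x ^ (4 * n - 1) * ray_deriv (ray_deriv f) x = 1)"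


section \<open>The complexification of complex projective space\<close>

definition Gr :: "nat \<Rightarrow> (complex ^ 'k::finite) set set" where
  "Gr d = {P. vec.subspace P \<and> vec.dim P = d}"

text \<open>
  With \<open>n = CARD('m)\<close>, homogeneous coordinates on \<open>\<complex>P\<^sup>n\<close> are indexed by \<open>'m option\<close>, the index
  \<open>0\<close> being \<open>None\<close>.
\<close>

type_synonym 'm point_II = "(complex ^ ('m option)) set \<times> (complex ^ ('m option)) set"

definition M_II :: "'m::finite point_II set" where
  "M_II = Gr 1 \<times> Gr 1
     - {(vec.span {z}, vec.span {w}) | z w. z \<noteq> 0 \<and> w \<noteq> 0 \<and> (\<Sum>j\<in>UNIV. z $ j * w $ j) = 0}"

definition norm_fun_II :: "complex ^ 'k::finite \<Rightarrow> complex ^ 'k \<Rightarrow> real" where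
  "norm_fun_II z w =
     (\<Sum>j\<in>UNIV. (cmod (z $ j))\<^sup>2) * (\<Sum>j\<in>UNIV. (cmod (w $ j))\<^sup>2)
       / (cmod (\<Sum>j\<in>UNIV. z $ j * w $ j))\<^sup>2"

definition N_II :: "'m::finite point_II \<Rightarrow> real" where
  "N_II p = (THE r. \<exists>z w. z \<noteq> 0 \<and> w \<noteq> 0 \<and> p = (vec.span {z}, vec.span {w}) \<and> r = norm_fun_II z w)"

text \<open>
  Affine coordinates in which the homogeneous coordinate with index \<open>inv p None\<close> equals \<open>1\<close>; the
  permutation \<open>p\<close> is the identity for the chart \<open>z\<^sub>0 = 1\<close>.
\<close>

definition affine_vec :: "('m option \<Rightarrow> 'm option) \<Rightarrow> ('m \<Rightarrow> complex) \<Rightarrow> complex ^ ('m::finite option)" where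
  "affine_vec p \<zeta> = (\<chi> i. case p i of None \<Rightarrow> 1 | Some j \<Rightarrow> \<zeta> j)"

definition param_II ::
    "('m option \<Rightarrow> 'm option) \<Rightarrow> ('m option \<Rightarrow> 'm option) \<Rightarrow> complex ^ ('m + 'm) \<Rightarrow> 'm::finite point_II" where
  "param_II p q x =
     (vec.span {affine_vec p (\<lambda>j. x $ Inl j)}, vec.span {affine_vec q (\<lambda>j. x $ Inr j)})"

definition atlas_II :: "('m::finite point_II, 'm + 'm) chart set" where
  "atlas_II = {({x. param_II p q x \<in> M_II}, param_II p q) | p q. bij p \<and> bij q}"

definition g_II :: "(real \<Rightarrow> real) \<Rightarrow> ('m::finite point_II, 'm + 'm) hermitian_metric" where
  "g_II f = kahler_metric (\<lambda>p. f (N_II p))"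


section \<open>The complexification of quaternionic projective space\<close>

text \<open>
  Coordinates on \<open>\<complex>\<^bsup>2n+2\<^esup>\<close> are indexed by \<open>'m option \<times> bool\<close>: the pair \<open>(j, False), (j, True)\<close>
  stands for the \<open>j\<close>-th pair of indices \<open>2j-1, 2j\<close>, and \<open>(None, False), (None, True)\<close> for the last
  pair \<open>2n+1, 2n+2\<close>.
\<close>

type_synonym 'm point_III = "(complex ^ ('m option \<times> bool)) set"

definition sympl :: "complex ^ ('k::finite \<times> bool) \<Rightarrow> complex ^ ('k \<times> bool) \<Rightarrow> complex" where
  "sympl z w = (\<Sum>j\<in>UNIV. z $ (j, True) * w $ (j, False) - z $ (j, False) * w $ (j, True))"

definition M_III :: "'m::finite point_III set" where
  "M_III = Gr 2 - {vec.span {z, w} | z w. vec.dim (vec.span {z, w}) = 2 \<and> sympl z w = 0}"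

definition norm_fun_III :: "complex ^ ('k::finite \<times> bool) \<Rightarrow> complex ^ ('k \<times> bool) \<Rightarrow> real" where
  "norm_fun_III z w =
     ((\<Sum>j\<in>UNIV. (cmod (z $ j))\<^sup>2) * (\<Sum>j\<in>UNIV. (cmod (w $ j))\<^sup>2)
        - (cmod (\<Sum>j\<in>UNIV. z $ j * cnj (w $ j)))\<^sup>2)
       / (cmod (sympl z w))\<^sup>2"

definition N_III :: "'m::finite point_III \<Rightarrow> real" where
  "N_III P = (THE r. \<exists>z w. vec.dim (vec.span {z, w}) = 2 \<and> P = vec.span {z, w} \<and> r = norm_fun_III z w)"

text \<open>
  Inhomogeneous coordinates in which the basis of the plane has the columns \<open>(1, 0)\<close> and \<open>(0, 1)\<close>
  at two chosen indices; for \<open>p\<close> the identity these are the last two indices.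
\<close>

definition frame_vec ::
    "('m option \<times> bool \<Rightarrow> 'm option \<times> bool) \<Rightarrow> bool \<Rightarrow> ('m \<times> bool \<Rightarrow> complex)
       \<Rightarrow> complex ^ ('m::finite option \<times> bool)" where
  "frame_vec p c \<zeta> =
     (\<chi> i. case p i of (None, b) \<Rightarrow> (if b = c then 1 else 0) | (Some j, b) \<Rightarrow> \<zeta> (j, b))"

definition param_III ::
    "('m option \<times> bool \<Rightarrow> 'm option \<times> bool) \<Rightarrow> complex ^ ('m \<times> bool + 'm \<times> bool)
       \<Rightarrow> 'm::finite point_III" where
  "param_III p x =
     vec.span {frame_vec p False (\<lambda>j. x $ Inl j), frame_vec p True (\<lambda>j. x $ Inr j)}"

definition atlas_III :: "('m::finite point_III, 'm \<times> bool + 'm \<times> bool) chart set" where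
  "atlas_III = {({x. param_III p x \<in> M_III}, param_III p) | p. bij p}"

definition g_III ::
    "(real \<Rightarrow> real) \<Rightarrow> ('m::finite point_III, 'm \<times> bool + 'm \<times> bool) hermitian_metric" where
  "g_III f = kahler_metric (\<lambda>P. f (N_III P))"


section \<open>Well-definedness\<close>

text \<open>
  \<open>\<N>\<close> does not depend on the chosen representatives; the charts have open domains and cover;
  the ordinary differential equations for \<open>f\<close> have smooth solutions.
\<close>

lemma N_II_span:
  assumes "z \<noteq> 0" "w \<noteq> 0"
  shows "N_II (vec.span {z}, vec.span {w}) = norm_fun_II z w"
  unfolding N_II_def
proof (rule the_equality)
  fix r
  assume "\<exists>z' w'. z' \<noteq> 0 \<and> w' \<noteq> 0 \<and> (vec.span {z}, vec.span {w}) = (vec.span {z'}, vec.span {w'})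
    \<and> r = norm_fun_II z' w'"
  then obtain z' w' where *: "z' \<noteq> 0" "w' \<noteq> 0" "vec.span {z} = vec.span {z'}"
      "vec.span {w} = vec.span {w'}" "r = norm_fun_II z' w'" by blast
  have "z' \<in> vec.span {z}" "w' \<in> vec.span {w}"
    using * by (simp_all add: vec.span_base)
  then obtain a b where ab: "z' = a *s z" "w' = b *s w"
    by (auto simp: vec.span_singleton)
  then have ne: "a \<noteq> 0" "b \<noteq> 0" using * by auto
  have "(\<Sum>j\<in>UNIV. (a * z $ j) * (b * w $ j)) = a * b * (\<Sum>j\<in>UNIV. z $ j * w $ j)"
    by (simp add: sum_distrib_left mult_ac)
  then show "r = norm_fun_II z w"
    using ne * by (simp add: ab norm_fun_II_def norm_mult power_mult_distrib flip: sum_distrib_left)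
qed (use assms in blast)

lemma gram_combination:
  fixes z w :: "complex ^ 'k::finite" and a b c d :: complex
  defines "G \<equiv> \<lambda>u v :: complex ^ 'k. (\<Sum>j\<in>UNIV. (cmod (u $ j))\<^sup>2) * (\<Sum>j\<in>UNIV. (cmod (v $ j))\<^sup>2)
        - (cmod (\<Sum>j\<in>UNIV. u $ j * cnj (v $ j)))\<^sup>2"
  shows "G (a *s z + b *s w) (c *s z + d *s w) = (cmod (a * d - b * c))\<^sup>2 * G z w"
proof -
  define h where "h = (\<lambda>u v :: complex ^ 'k. \<Sum>j\<in>UNIV. u $ j * cnj (v $ j))"
  have sq: "complex_of_real (\<Sum>j\<in>UNIV. (cmod (u $ j))\<^sup>2) = h u u" for u
    by (simp add: h_def complex_norm_square del: of_real_power)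
  have cn: "cnj (h u v) = h v u" for u v
    by (simp add: h_def mult.commute)
  have G: "of_real (G u v) = h u u * h v v - h u v * h v u" for u v
  proof -
    have G': "G u v = (\<Sum>j\<in>UNIV. (cmod (u $ j))\<^sup>2) * (\<Sum>j\<in>UNIV. (cmod (v $ j))\<^sup>2) - (cmod (h u v))\<^sup>2"
      by (simp add: G_def h_def)
    show ?thesis unfolding G' of_real_diff of_real_mult sq complex_norm_square cn ..
  qed
  have lin: "h (a *s z + b *s w) v = a * h z v + b * h w v" for a b z w v
    by (simp add: h_def algebra_simps sum.distrib sum_distrib_left)
  have lin': "h v (a *s z + b *s w) = cnj a * h v z + cnj b * h v w" for a b z w v
    by (simp add: h_def algebra_simps sum.distrib sum_distrib_left)
  have "complex_of_real (G (a *s z + b *s w) (c *s z + d *s w))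
    = of_real ((cmod (a * d - b * c))\<^sup>2 * G z w)"
    unfolding of_real_mult G complex_norm_square lin lin' by (simp add: algebra_simps)
  then show ?thesis by (simp only: of_real_eq_iff)
qed

lemma sympl_combination:
  "sympl (a *s z + b *s w) (c *s z + d *s w) = (a * d - b * c) * sympl z w"
  unfolding sympl_def sum_distrib_left by (rule sum.cong) (simp_all add: algebra_simps)

lemma vec_span2_D: "v \<in> vec.span {z, w} \<Longrightarrow> \<exists>a b. v = a *s z + b *s w"
  by (auto simp: vec.span_insert vec.span_singleton) (metis add.commute diff_add_cancel)

lemma vec_span2_eqD:
  assumes "vec.dim (vec.span {z', w'}) = 2" "vec.span {z, w} = vec.span {z', w'}"
  obtains a b c d where "z' = a *s z + b *s w" "w' = c *s z + d *s w" "a * d - b * c \<noteq> 0"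
proof -
  have "z' \<in> vec.span {z, w}" "w' \<in> vec.span {z, w}"
    using assms by (simp_all add: vec.span_base)
  then obtain a b c d where ab: "z' = a *s z + b *s w" "w' = c *s z + d *s w"
    using vec_span2_D by metis
  have "a * d - b * c \<noteq> 0"
  proof
    assume det: "a * d - b * c = 0"
    have "\<exists>v. z' \<in> vec.span {v} \<and> w' \<in> vec.span {v}"
    proof (cases "a = 0 \<and> b = 0")
      case True
      then show ?thesis by (intro exI[of _ w']) (simp add: ab vec.span_base vec.span_zero)
    next
      case False
      have "w' \<in> vec.span {z'}"
      proof (cases "a = 0")
        case True
        then have "w' = (d / b) *s z'" using False det by (simp add: ab)
        then show ?thesis by (metis rangeI vec.span_singleton)
      next
        case a: False
        then have "d = b * c / a" using det by (simp add: field_simps)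
        then have "w' = (c / a) *s z'" using a by (simp add: ab vec_eq_iff field_simps)
        then show ?thesis by (metis rangeI vec.span_singleton)
      qed
      then show ?thesis by (meson singletonI vec.span_base)
    qed
    then obtain v where "{z', w'} \<subseteq> vec.span {v}" by auto
    then have "vec.dim {z', w'} \<le> card {v}"
      by (intro vec.dim_le_card) auto
    then show False using assms by simp
  qed
  then show ?thesis using that ab by blast
qed

lemma N_III_span:
  assumes "vec.dim (vec.span {z, w}) = 2"
  shows "N_III (vec.span {z, w}) = norm_fun_III z w"
  unfolding N_III_def
proof (rule the_equality)
  fix r
  assume "\<exists>z' w'. vec.dim (vec.span {z', w'}) = 2 \<and> vec.span {z, w} = vec.span {z', w'}
    \<and> r = norm_fun_III z' w'"
  then obtain z' w' where *: "vec.dim (vec.span {z', w'}) = 2" "vec.span {z, w} = vec.span {z', w'}"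
      "r = norm_fun_III z' w'" by blast
  obtain a b c d where ab: "z' = a *s z + b *s w" "w' = c *s z + d *s w" "a * d - b * c \<noteq> 0"
    using vec_span2_eqD[OF *(1,2)] by blast
  then show "r = norm_fun_III z w"
    using *(3) ab(3)
    by (simp only: ab(1,2) norm_fun_III_def gram_combination sympl_combination norm_mult
        power_mult_distrib) (simp)
qed (use assms in blast)

lemma mem_M_II:
  assumes "z \<noteq> 0" "w \<noteq> 0"
  shows "(vec.span {z}, vec.span {w}) \<in> M_II \<longleftrightarrow> (\<Sum>j\<in>UNIV. z $ j * w $ j) \<noteq> 0"
proof -
  have "(\<Sum>j\<in>UNIV. z $ j * w $ j) = 0"
    if "z' \<noteq> 0" "w' \<noteq> 0" "vec.span {z} = vec.span {z'}" "vec.span {w} = vec.span {w'}"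
       "(\<Sum>j\<in>UNIV. z' $ j * w' $ j) = 0" for z' w'
  proof -
    have "z \<in> vec.span {z'}" "w \<in> vec.span {w'}"
      using that(3,4) by (metis insertI1 vec.span_base)+
    then obtain a b where ab: "z = a *s z'" "w = b *s w'"
      by (auto simp: vec.span_singleton)
    have "(\<Sum>j\<in>UNIV. z $ j * w $ j) = a * b * (\<Sum>j\<in>UNIV. z' $ j * w' $ j)"
      by (simp add: ab sum_distrib_left mult_ac)
    then show ?thesis using that by simp
  qed
  then show ?thesis using assms by (auto simp: M_II_def Gr_def)
qed

lemma affine_vec_nz: "bij p \<Longrightarrow> affine_vec p \<zeta> \<noteq> 0"
  by (metis (no_types, lifting) affine_vec_def bij_pointE option.simps(4) vec_lambda_beta
      zero_index zero_neq_one)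

lemma open_chart_II:
  fixes p q :: "'m::finite option \<Rightarrow> 'm option"
  assumes "bij p" "bij q"
  shows "open {x. param_II p q x \<in> M_II}"
proof -
  have c: "continuous_on UNIV (\<lambda>x::complex^('m+'m). affine_vec p (\<lambda>j. x $ f j) $ i)" for p i and f :: "'m \<Rightarrow> 'm + 'm"
    by (auto simp: affine_vec_def intro!: continuous_intros split: option.splits) (cases "p i"; auto intro!: continuous_intros)
  have "{x. param_II p q x \<in> M_II} = {x::complex^('m+'m).
     (\<Sum>i\<in>UNIV. affine_vec p (\<lambda>j. x $ Inl j) $ i * affine_vec q (\<lambda>j. x $ Inr j) $ i) \<noteq> 0}"
    using assms by (simp add: param_II_def mem_M_II affine_vec_nz)
  also have "open \<dots>"
    by (intro open_Collect_neq continuous_intros c)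
  finally show ?thesis .
qed

lemma Gr1_D:
  assumes "L \<in> Gr 1" obtains z where "z \<noteq> 0" "L = vec.span {z}"
proof -
  have "vec.subspace L" "vec.dim L = 1" using assms by (auto simp: Gr_def)
  then obtain B where B: "B \<subseteq> L" "vec.independent B" "L \<subseteq> vec.span B" "card B = 1"
    using vec.basis_exists[of L] by metis
  then obtain z where z: "B = {z}" by (auto simp: card_1_singleton_iff)
  have "z \<noteq> 0" using B z by auto
  moreover have "L = vec.span {z}"
    using B z \<open>vec.subspace L\<close> by (metis subset_antisym vec.span_minimal)
  ultimately show ?thesis using that by blast
qed

lemma line_affine:
  assumes "z \<noteq> 0"
  obtains p \<zeta> where "bij p" "vec.span {z} = vec.span {affine_vec p \<zeta>}"
proof -
  obtain i where i: "z $ i \<noteq> 0" using assms by (auto simp: vec_eq_iff)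
  define p where "p = Transposition.transpose i None"
  have "affine_vec p (\<lambda>j. z $ (p (Some j)) / z $ i) = (1 / z $ i) *s z"
  proof (rule vec_eq_iff[THEN iffD2], rule allI)
    fix k
    have pp: "p (p k) = k" by (simp add: p_def)
    show "affine_vec p (\<lambda>j. z $ (p (Some j)) / z $ i) $ k = ((1 / z $ i) *s z) $ k"
    proof (cases "p k")
      case None
      then have "k = i" using pp by (simp add: p_def)
      then show ?thesis using i None by (simp add: affine_vec_def)
    next
      case (Some j)
      then show ?thesis using pp by (simp add: affine_vec_def)
    qed
  qed
  moreover have "vec.span {c *s z} = vec.span {z}" if "c \<noteq> 0" for c
    using that vec.span_image_scale[of "{z}" "\<lambda>_. c"] by simp
  moreover have "bij p" by (simp add: p_def)
  ultimately show ?thesis using that i by (metis divide_eq_0_iff zero_neq_one)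
qed

lemma atlas_II_covers: "(\<Union>(U, \<psi>)\<in>atlas_II. \<psi> ` U) = M_II"
proof (intro equalityI subsetI)
  fix P :: "'a point_II" assume P: "P \<in> M_II"
  obtain L K where LK: "P = (L, K)" by (cases P)
  with P have "L \<in> Gr 1" "K \<in> Gr 1" by (auto simp: M_II_def)
  then obtain p q \<zeta> \<eta> where pq: "bij p" "bij q" "L = vec.span {affine_vec p \<zeta>}" "K = vec.span {affine_vec q \<eta>}"
    by (metis Gr1_D line_affine)
  define x where "x = (\<chi> i. case i of Inl j \<Rightarrow> \<zeta> j | Inr j \<Rightarrow> \<eta> j)"
  have "P = param_II p q x" by (simp add: LK pq param_II_def x_def)
  then show "P \<in> (\<Union>(U, \<psi>)\<in>atlas_II. \<psi> ` U)"
    using P pq(1,2) unfolding atlas_II_def by blast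
qed (auto simp: atlas_II_def)

lemma mem_M_III:
  assumes "vec.dim (vec.span {z, w}) = 2"
  shows "vec.span {z, w} \<in> M_III \<longleftrightarrow> sympl z w \<noteq> 0"
proof -
  have "sympl z w = 0" if "vec.span {z, w} = vec.span {z', w'}" "sympl z' w' = 0" for z' w'
    using vec_span2_eqD[of z w z' w'] assms that by (metis sympl_combination mult_zero_right)
  moreover have "vec.span {z, w} \<in> Gr 2" using assms by (simp add: Gr_def)
  ultimately show ?thesis using assms unfolding M_III_def by blast
qed

lemma dim2_if:
  assumes "z $ i = 1" "z $ k = 0" "w $ i = 0" "w $ k = 1"
  shows "vec.dim (vec.span {z, w}) = 2"
proof -
  have "vec.independent {z, w}"
  proof -
    have "z \<notin> vec.span {w}" using assms by (auto simp: vec.span_singleton)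
    moreover have "w \<noteq> 0" using assms by auto
    ultimately show ?thesis by (simp add: vec.independent_insert)
  qed
  moreover have "z \<noteq> w" using assms by auto
  ultimately show ?thesis by (simp add: vec.dim_eq_card_independent)
qed

lemma dim_frame:
  assumes "bij p"
  shows "vec.dim (vec.span {frame_vec p False \<zeta>, frame_vec p True \<eta>}) = 2"
proof -
  obtain i k where "p i = (None, False)" "p k = (None, True)"
    using assms by (metis bij_pointE)
  then show ?thesis by (intro dim2_if[of _ i k]) (auto simp: frame_vec_def)
qed

lemma open_chart_III:
  fixes p :: "'m::finite option \<times> bool \<Rightarrow> 'm option \<times> bool"
  assumes "bij p"
  shows "open {x. param_III p x \<in> M_III}"
proof -
  have c: "continuous_on UNIV (\<lambda>x::complex^('m \<times> bool+'m \<times> bool). frame_vec p c (\<lambda>j. x $ f j) $ i)" for i c and f :: "'m \<times> bool \<Rightarrow> 'm \<times> bool + 'm \<times> bool"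
    by (cases "p i"; cases "fst (p i)") (auto simp: frame_vec_def intro!: continuous_intros)
  have "{x. param_III p x \<in> M_III} = {x::complex^('m \<times> bool+'m \<times> bool).
     sympl (frame_vec p False (\<lambda>j. x $ Inl j)) (frame_vec p True (\<lambda>j. x $ Inr j)) \<noteq> 0}"
    using assms by (simp add: param_III_def mem_M_III dim_frame del: vec.dim_span)
  also have "open \<dots>"
    unfolding sympl_def by (intro open_Collect_neq continuous_intros c)
  finally show ?thesis .
qed

lemma atlas_III_covers: "(\<Union>(U, \<psi>)\<in>atlas_III. \<psi> ` U) = M_III"
proof (intro equalityI subsetI)
  fix P :: "'a point_III" assume P: "P \<in> M_III"
  then have S: "vec.subspace P" and D: "vec.dim P = 2" by (auto simp: M_III_def Gr_def)
  obtain B where B: "B \<subseteq> P" "vec.independent B" "P \<subseteq> vec.span B" "card B = 2"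
    using vec.basis_exists[of P] D by metis
  then obtain z w where zw: "B = {z, w}" "z \<noteq> w" by (auto simp: card_2_iff)
  have Pz: "P = vec.span {z, w}" using B zw S by (metis subset_antisym vec.span_minimal)
  have z0: "z \<noteq> 0" using B zw vec.dependent_zero by blast
  then obtain i where i: "z $ i \<noteq> 0" by (auto simp: vec_eq_iff)
  have "\<exists>k. z $ i * w $ k \<noteq> z $ k * w $ i"
  proof (rule ccontr)
    assume "\<not> ?thesis"
    then have "w = (w $ i / z $ i) *s z" using i by (simp add: vec_eq_iff field_simps)
    then have "w \<in> vec.span {z}" by (metis rangeI vec.span_singleton)
    moreover have "w \<notin> vec.span ({z, w} - {w})" using B(2) zw unfolding vec.dependent_def by blast
    moreover have "{z, w} - {w} = {z}" using zw by auto
    ultimately show False by simp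
  qed
  then obtain k where k: "z $ i * w $ k - z $ k * w $ i \<noteq> 0" by auto
  then have ik: "i \<noteq> k" by auto
  define dd where "dd = z $ i * w $ k - z $ k * w $ i"
  define u where "u = (w $ k / dd) *s z + (- z $ k / dd) *s w"
  define v where "v = (- w $ i / dd) *s z + (z $ i / dd) *s w"
  have dd: "dd \<noteq> 0" using k by (simp add: dd_def)
  have uv: "u $ i = 1" "u $ k = 0" "v $ i = 0" "v $ k = 1"
    using dd by (auto simp: u_def v_def field_simps) (auto simp: dd_def algebra_simps)
  have "u \<in> P" "v \<in> P"
    unfolding Pz u_def v_def by (intro vec.span_add vec.span_scale vec.span_base; simp)+
  have Puv: "P = vec.span {u, v}"
  proof (rule vec.subspace_dim_equal[symmetric])
    show "vec.span {u, v} \<subseteq> P"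
      using \<open>u \<in> P\<close> \<open>v \<in> P\<close> S by (simp add: vec.span_minimal)
    show "vec.dim P \<le> vec.dim (vec.span {u, v})"
      using D dim2_if[OF uv] by simp
  qed (use S in auto)
  define k' where "k' = Transposition.transpose i (None, False) k"
  define p where "p = Transposition.transpose k' (None, True) \<circ> Transposition.transpose i (None, False)"
  have k'ne: "k' \<noteq> (None, False)" using ik by (auto simp: k'_def Transposition.transpose_def)
  have p: "bij p" "p i = (None, False)" "p k = (None, True)"
    using k'ne by (auto simp: p_def bij_comp k'_def[symmetric]) 
  define x where "x = (\<chi> a. case a of Inl jb \<Rightarrow> u $ (inv p (Some (fst jb), snd jb)) | Inr jb \<Rightarrow> v $ (inv p (Some (fst jb), snd jb)))"
  have inj: "inv p (p a) = a" for a using p by (simp add: bij_is_inj)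
  have fr: "frame_vec p False (\<lambda>j. x $ Inl j) $ a = u $ a \<and> frame_vec p True (\<lambda>j. x $ Inr j) $ a = v $ a" for a
  proof (cases "p a")
    case (Pair c b)
    show ?thesis
    proof (cases c)
      case None
      then have "a = (if b then k else i)" using Pair p by (metis (full_types) inj)
      then show ?thesis using Pair None uv by (auto simp: frame_vec_def)
    next
      case (Some j)
      have "inv p (Some j, b) = a" using inj[of a] Pair Some by simp
      then show ?thesis using Pair Some by (auto simp: frame_vec_def x_def)
    qed
  qed
  have "frame_vec p False (\<lambda>j. x $ Inl j) = u" "frame_vec p True (\<lambda>j. x $ Inr j) = v"
    using fr by (simp_all add: vec_eq_iff)
  then have "P = param_III p x" by (simp add: param_III_def Puv)
  then show "P \<in> (\<Union>(U, \<psi>)\<in>atlas_III. \<psi> ` U)"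
    using P p(1) unfolding atlas_III_def by blast
qed (auto simp: atlas_III_def)


inductive_set powr_sums :: "real \<Rightarrow> real \<Rightarrow> (real \<Rightarrow> real) set" for A B where
  mono: "(\<lambda>x. c * x powr a * (A + B * x) powr b) \<in> powr_sums A B"
| add: "g \<in> powr_sums A B \<Longrightarrow> h \<in> powr_sums A B \<Longrightarrow> (\<lambda>x. g x + h x) \<in> powr_sums A B"

lemma powr_sums_deriv:
  assumes "A > 0" "B \<ge> 0" "g \<in> powr_sums A B"
  shows "\<exists>g'\<in>powr_sums A B. \<forall>x\<ge>1. (g has_real_derivative g' x) (at x)"
  using assms(3)
proof induction
  case (mono c a b)
  show ?case
  proof (rule bexI, intro allI impI)
    fix x :: real assume x: "1 \<le> x"
    have p: "A + B * x > 0" using assms(1,2) x by (simp add: add_pos_nonneg)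
    show "((\<lambda>x. c * x powr a * (A + B * x) powr b) has_real_derivative 
      ((c * a) * x powr (a - 1) * (A + B * x) powr b + (c * b * B) * x powr a * (A + B * x) powr (b - 1))) (at x)"
      using x p by (auto intro!: derivative_eq_intros simp: algebra_simps)
  qed (intro powr_sums.intros)
next
  case (add g h)
  then obtain g' h' where "g' \<in> powr_sums A B" "h' \<in> powr_sums A B" "\<forall>x\<ge>1. (g has_real_derivative g' x) (at x)"
     "\<forall>x\<ge>1. (h has_real_derivative h' x) (at x)" by blast
  then show ?case by (intro bexI[of _ "\<lambda>x. g' x + h' x"]) (auto intro: powr_sums.intros DERIV_add)
qed

lemma ray_deriv_eq:
  assumes "(f has_real_derivative d) (at x within {1..})" "x \<ge> 1"
  shows "ray_deriv f x = d"
proof -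
  have "at x within {1..} \<noteq> bot"
  proof -
    have "at x within {x<..} \<le> at x within {1..}" using assms(2) by (intro at_le) auto
    then show ?thesis using trivial_limit_at_right_real[of x] by (metis bot.extremum_uniqueI)
  qed
  then show ?thesis unfolding ray_deriv_def
    using assms(1) vector_derivative_within has_real_derivative_iff_has_vector_derivative by blast
qed

lemma ray_transform:
  assumes "(f has_real_derivative d) (at x within {1..})" "x \<ge> 1" "\<And>y. y \<ge> 1 \<Longrightarrow> g y = f y"
  shows "(g has_real_derivative d) (at x within {1..})"
  by (rule has_field_derivative_transform_within[OF assms(1), of 1]) (use assms in auto)

lemma powr_sums_ray_deriv:
  assumes "A > 0" "B \<ge> 0" "\<exists>h\<in>powr_sums A B. \<forall>x\<ge>1. g x = h x"
  shows "(\<exists>h\<in>powr_sums A B. \<forall>x\<ge>1. ray_deriv g x = h x) \<and> (\<forall>x\<ge>1. g differentiable (at x within {1..}))"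
proof -
  obtain h where h: "h \<in> powr_sums A B" "\<forall>x\<ge>1. g x = h x" using assms by blast
  obtain h' where h': "h' \<in> powr_sums A B" "\<forall>x\<ge>1. (h has_real_derivative h' x) (at x)"
    using powr_sums_deriv[OF assms(1,2) h(1)] by blast
  have "(g has_real_derivative h' x) (at x within {1..})" if "x \<ge> 1" for x
    by (rule ray_transform[OF has_field_derivative_at_within]) (use h'(2) that h(2) in auto)
  then show ?thesis using h'(1) ray_deriv_eq real_differentiable_def by blast
qed

lemma smooth_on_ray_powr_sums:
  assumes "A > 0" "B \<ge> 0" "h \<in> powr_sums A B" "\<And>x. x \<ge> 1 \<Longrightarrow> (f has_real_derivative h x) (at x within {1..})"
  shows "smooth_on_ray f"
proof -
  have *: "(\<exists>h\<in>powr_sums A B. \<forall>x\<ge>1. (ray_deriv ^^ Suc k) f x = h x)" for k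
  proof (induction k)
    case 0 then show ?case using ray_deriv_eq[OF assms(4)] assms(3) by auto
  next
    case (Suc k) then show ?case using powr_sums_ray_deriv[OF assms(1,2)] by simp
  qed
  show ?thesis unfolding smooth_on_ray_def
  proof (intro allI impI)
    fix k x assume "(1::real) \<le> x"
    then show "(ray_deriv ^^ k) f differentiable at x within {1..}"
    proof (cases k)
      case 0 then show ?thesis using assms(4)[OF \<open>1 \<le> x\<close>] by (auto simp: real_differentiable_def)
    next
      case (Suc m) then show ?thesis using powr_sums_ray_deriv[OF assms(1,2) *] \<open>1 \<le> x\<close> by metis
    qed
  qed
qed

lemma powr_sums_antideriv:
  assumes "A > 0" "B \<ge> 0" "h \<in> powr_sums A B"
  shows "\<exists>f. f 1 = 0 \<and> (\<forall>x\<ge>1. (f has_real_derivative h x) (at x within {1..}))"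
proof (intro exI[of _ "\<lambda>x. integral {1..x} h"] conjI allI impI)
  fix x :: real assume x: "1 \<le> x"
  have "continuous_on {1..x+1} h"
    using powr_sums_deriv[OF assms] by (meson DERIV_isCont atLeastAtMost_iff continuous_at_imp_continuous_on)
  from integral_has_real_derivative[OF this, of x]
  have "((\<lambda>x. integral {1..x} h) has_real_derivative h x) (at x within {1..x+1})" using x by simp
  moreover have "at x within {1..x+1} = at x within {1..}"
    by (rule at_within_nhd[of _ "{..<x+1}"]) (use x in auto)
  ultimately show "((\<lambda>x. integral {1..x} h) has_real_derivative h x) (at x within {1..})" by simp
qed simp

lemma powr_minus_three_halves: "x \<ge> 1 \<Longrightarrow> x powr (- (3/2)) = x powr (- (1/2)) / (x::real)"
  using powr_diff[of x "-1/2" 1] by simp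

lemma powr_minus_one_real: "y > 0 \<Longrightarrow> y powr (r - 1) = y powr r / (y::real)"
  using powr_diff[of y r 1] by simp

lemma profile_III_cancel: "P \<noteq> 0 \<Longrightarrow> x \<ge> 1 \<Longrightarrow> (c * P + d * (x * P) * q) * (y / (x ^ 2 * P)) = (c + d * x * q) * y / x ^ 2" for x :: real
  by (simp add: field_simps power2_eq_square)

lemma profile_II_exists: 
  assumes "n \<ge> 1" shows "\<exists>f. profile_II n f"
proof -
  let ?h = "\<lambda>x::real. 1 * x powr (-1/2) * (1 + 0 * x) powr 0"
  have S: "?h \<in> powr_sums 1 0" by (rule powr_sums.mono)
  obtain f where f: "f 1 = 0" "\<forall>x\<ge>1. (f has_real_derivative ?h x) (at x within {1..})"
    using powr_sums_antideriv[OF _ _ S] by auto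
  have r: "ray_deriv f x = x powr (-1/2)" if "x \<ge> 1" for x using ray_deriv_eq[OF f(2)[rule_format, OF that] that] by simp
  have r2: "ray_deriv (ray_deriv f) x = (-1/2) * x powr (-1/2) / x" if "x \<ge> 1" for x
  proof (rule ray_deriv_eq[OF _ that])
    have "((\<lambda>x. x powr (-1/2)) has_real_derivative (-1/2) * x powr (-1/2) / x) (at x within {1..})"
      using that powr_minus_three_halves[OF that] by (auto intro!: derivative_eq_intros)
    then show "(ray_deriv f has_real_derivative (-1/2) * x powr (-1/2) / x) (at x within {1..})"
      by (rule ray_transform[OF _ that]) (use r in simp)
  qed
  have "profile_II n f"
    unfolding profile_II_def
  proof (intro conjI allI impI)
    show "smooth_on_ray f" by (rule smooth_on_ray_powr_sums[OF _ _ S]) (use f in auto)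
    show "ray_deriv f 1 = 1" by (simp add: r)
    fix x :: real assume x: "1 \<le> x"
    define u where "u = x powr (-1/2)"
    have u2: "u ^ 2 = 1 / x" using x by (simp add: u_def power2_eq_square flip: powr_add)
    obtain m where m: "n = Suc m" using assms by (metis Suc_le_D One_nat_def)
    have e: "u ^ (2 * n - 1) * u = u ^ (2 * n)" by (simp add: m)
    have U: "u ^ (2 * n) = 1 / x ^ n" by (simp add: power_mult u2 power_divide)
    have "(2 * x - 1) * x ^ (n - 1) * u ^ (2 * n) + 2 * (x - 1) * x ^ n * u ^ (2 * n - 1) * ((-1/2) * u / x)
       = (2 * x - 1) * x ^ (n - 1) * u ^ (2 * n) - (x - 1) * x ^ n * (u ^ (2 * n - 1) * u) / x" 
      using x by (simp add: divide_simps) 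
    also have "\<dots> = 1" unfolding e U using x by (simp add: m field_simps)
    finally show "(2 * x - 1) * x ^ (n - 1) * ray_deriv f x ^ (2 * n)
        + 2 * (x - 1) * x ^ n * ray_deriv f x ^ (2 * n - 1) * ray_deriv (ray_deriv f) x = 1"
      using x by (simp add: r r2 u_def)
  qed
  then show ?thesis by blast
qed

lemma profile_III_exists: 
  assumes "n \<ge> 1" shows "\<exists>f. profile_III n f"
proof -
  define A where "A = 1 / (2 * real n + 1)"
  define B where "B = 2 * real n / (2 * real n + 1)"
  have AB: "A > 0" "B \<ge> 0" "A + B = 1" "B = 2 * real n * A"
    by (auto simp: A_def B_def simp flip: add_divide_distrib)
  let ?h = "\<lambda>x::real. 1 * x powr (-1/2) * (A + B * x) powr (1 / (4 * real n))"
  have S: "?h \<in> powr_sums A B" by (rule powr_sums.mono)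
  obtain f where f: "f 1 = 0" "\<forall>x\<ge>1. (f has_real_derivative ?h x) (at x within {1..})"
    using powr_sums_antideriv[OF AB(1,2) S] by auto
  have r: "ray_deriv f x = ?h x" if "x \<ge> 1" for x using ray_deriv_eq[OF f(2)[rule_format, OF that] that] by simp
  have r2: "ray_deriv (ray_deriv f) x = ?h x * (-1 / (2 * x) + B / (4 * real n * (A + B * x)))" if x: "x \<ge> 1" for x
  proof (rule ray_deriv_eq[OF _ that])
    have p: "A + B * x > 0" using AB x by (simp add: add_pos_nonneg)
    define b where "b = 1 / (4 * real n)"
    have "((\<lambda>x. 1 * x powr (-1/2) * (A + B * x) powr b) has_real_derivative
       (-1/2) * x powr (-1/2 - 1) * (A + B * x) powr b + b * B * x powr (-1/2) * (A + B * x) powr (b - 1)) (at x within {1..})"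
      using x p by (auto intro!: derivative_eq_intros simp: algebra_simps)
    also have "(-1/2) * x powr (-1/2 - 1) * (A + B * x) powr b + b * B * x powr (-1/2) * (A + B * x) powr (b - 1)
       = 1 * x powr (-1/2) * (A + B * x) powr b * (-1 / (2 * x) + B * b / (A + B * x))"
    proof -
      have "x powr (-1/2 - 1) = x powr (-1/2) / x" using powr_minus_one_real[of x "-1/2"] x by simp
      moreover have "(A + B * x) powr (b - 1) = (A + B * x) powr b / (A + B * x)" by (rule powr_minus_one_real[OF p])
      ultimately show ?thesis by (simp only:) (simp add: algebra_simps)
    qed
    finally have "(?h has_real_derivative ?h x * (-1 / (2 * x) + B / (4 * real n * (A + B * x)))) (at x within {1..})"
      by (simp add: b_def)
    then show "(ray_deriv f has_real_derivative ?h x * (-1 / (2 * x) + B / (4 * real n * (A + B * x)))) (at x within {1..})"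
      by (rule ray_transform[OF _ that]) (use r in simp)
  qed
  have "profile_III n f"
    unfolding profile_III_def
  proof (intro conjI allI impI)
    show "smooth_on_ray f" by (rule smooth_on_ray_powr_sums[OF AB(1,2) S]) (use f in auto)
    show "ray_deriv f 1 = 1" using AB by (simp add: r)
    fix x :: real assume x: "1 \<le> x"
    have p: "A + B * x > 0" using AB x by (simp add: add_pos_nonneg)
    define u where "u = ?h x"
    define s where "s = x powr (-1/2)"
    have s2: "s ^ 2 = 1 / x" using x by (simp add: s_def power2_eq_square flip: powr_add)
    have s4: "s ^ (4 * n) = 1 / x ^ (2 * n)"
    proof -
      have "s ^ (4 * n) = (s ^ 2) ^ (2 * n)" by (simp flip: power_mult)
      then show ?thesis by (simp add: s2 power_divide)
    qed
    have "((A + B * x) powr (1 / (4 * real n))) ^ (4 * n) = A + B * x"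
      using p assms by (simp add: powr_power)
    then have U: "u ^ (4 * n) = (A + B * x) / x ^ (2 * n)"
      using s4 by (simp add: u_def power_mult_distrib s_def)
    obtain m where m: "n = Suc m" using assms by (metis Suc_le_D One_nat_def)
    have e: "u ^ (4 * n - 1) * u = u ^ (4 * n)" using power_minus_mult[of "4 * n" u] assms by simp
    let ?q = "-1 / (2 * x) + B / (4 * real n * (A + B * x))"
    have "(2 * x - 1) * x ^ (2 * n - 2) * u ^ (4 * n) + 2 * (x - 1) * x ^ (2 * n - 1) * u ^ (4 * n - 1) * (u * ?q)
       = (2 * x - 1) * x ^ (2 * n - 2) * u ^ (4 * n) + 2 * (x - 1) * x ^ (2 * n - 1) * (u ^ (4 * n - 1) * u) * ?q"
      by (simp only: mult.assoc)
    also have "\<dots> = ((2 * x - 1) * x ^ (2 * n - 2) + 2 * (x - 1) * x ^ (2 * n - 1) * ?q) * ((A + B * x) / x ^ (2 * n))"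
      unfolding e U by (subst distrib_right) (simp only: mult_ac)
    also have "\<dots> = ((2 * x - 1) + 2 * (x - 1) * x * ?q) * (A + B * x) / x ^ 2"
    proof -
      define P where "P = x ^ (2 * m)"
      have "x ^ (2 * n - 2) = P" "x ^ (2 * n - 1) = x * P" "x ^ (2 * n) = x ^ 2 * P" "P \<noteq> 0"
        using x by (simp_all add: m P_def power2_eq_square)
      then show ?thesis using profile_III_cancel[OF \<open>P \<noteq> 0\<close> x] by presburger
    qed
    also have "2 * (x - 1) * x * ?q = - (x - 1) + (x - 1) * x * A / (A + B * x)"
      using x p assms by (simp add: divide_simps AB(4)) (simp add: algebra_simps)
    also have "((2 * x - 1) + (- (x - 1) + (x - 1) * x * A / (A + B * x))) * (A + B * x)
       = x * (A + B * x) + (x - 1) * x * A"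
      using p by (simp add: field_simps)
    also have "\<dots> = (A + B) * x ^ 2" by (simp add: algebra_simps power2_eq_square)
    finally have "(2 * x - 1) * x ^ (2 * n - 2) * u ^ (4 * n) + 2 * (x - 1) * x ^ (2 * n - 1) * u ^ (4 * n - 1) * (u * ?q) = 1"
      using AB x by simp
    then show "(2 * x - 1) * x ^ (2 * n - 2) * ray_deriv f x ^ (4 * n)
        + 2 * (x - 1) * x ^ (2 * n - 1) * ray_deriv f x ^ (4 * n - 1) * ray_deriv (ray_deriv f) x = 1"
      unfolding r2[OF x] r[OF x] u_def .
  qed (rule f)
  then show ?thesis by blast
qed

end

theory Submission
  imports Defs "HOL-Complex_Analysis.Complex_Analysis"
begin

text \<open>
  Each metric is ruled out by a single holomorphic disc.  For type II it lies in the chart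
  \<open>z\<^sub>0 = w\<^sub>0 = 1\<close>: all affine coordinates vanish except one coordinate \<open>s\<close> of \<open>z\<close>.  For type III it is
  the analogous coordinate line in the chart whose basis has the last columns \<open>(1, 0)\<close> and \<open>(0, 1)\<close>.
  On both lines \<open>\<N> = 1 + \<bar>s\<bar>\<^sup>2\<close>, so the restricted Kaehler potential \<open>c f(1 + \<bar>s\<bar>\<^sup>2)\<close> is radial.

  Suppose that the metric is induced by a holomorphic map to projective space, given in an affine
  chart near \<open>s = 0\<close> by the holomorphic curve \<open>H\<close> in \<open>\<ell>\<^sup>2\<close>.  Then \<open>ln (1 + \<parallel>H\<parallel>\<^sup>2)\<close> and
  \<open>c f(1 + \<bar>s\<bar>\<^sup>2)\<close> have the same mixed second derivative, so they differ by the real part of a holomorphic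
  function, and exponentiation makes \<open>exp (c f(1 + \<bar>s\<bar>\<^sup>2))\<close> a sum of squared moduli of holomorphic
  functions (\<open>potential_sum_of_squares\<close>).  This is Calabi's criterion for this disc.  The mean of
  such a sum over a circle of radius \<open>r\<close> is a power series in \<open>r\<^sup>2\<close> with nonnegative coefficients
  (\<open>radial_sum_of_squares_power_series\<close>).  Since the sum is radial, \<open>E(t) = exp (c f(1 + t))\<close> is itself
  such a power series, and all its derivatives are nonnegative for small \<open>t > 0\<close>.

  The differential equations for \<open>f\<close> are linear first-order equations for \<open>x\<^sup>k f'(x)\<^bsup>2k\<^esup>\<close>, with
  \<open>k = n\<close> in type II and \<open>k = 2n\<close> in type III.  They give \<open>f'(x) = x\<^bsup>-1/2\<^esup> (A + B x)\<^bsup>1/(2k)\<^esup>\<close> with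
  \<open>A = 1, B = 0\<close> in type II and \<open>A = 1/(k + 1), B = k/(k + 1)\<close> in type III
  (\<open>stenzel_ode_solution\<close>).  From this the fourth derivative of \<open>E\<close> at \<open>0\<close> is explicit, and it is
  negative for all \<open>0 < c \<le> 1\<close> (\<open>quartic_coefficient_negative\<close>), a contradiction.  In type III this
  needs \<open>n > 1\<close>: for \<open>n = 1\<close> and \<open>c = 1\<close> the fourth derivative is positive.
\<close>

section \<open>Circle means of holomorphic functions\<close>

lemma has_integral_cis_multiple:
  fixes k :: int
  shows "((\<lambda>\<theta>. cis (of_int k * \<theta>)) has_integral (if k = 0 then 2 * pi else 0)) {0..2*pi}"
proof (cases "k = 0")
  case True
  then show ?thesis
    using has_integral_const_real[of "1::complex" 0 "2*pi"] by (simp add: scaleR_conv_of_real)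
next
  case False
  have "((\<lambda>\<theta>. cis (of_int k * \<theta>)) has_integral
      cis (of_int k * (2*pi)) / (\<i> * of_int k) - cis (of_int k * 0) / (\<i> * of_int k)) {0..2*pi}"
  proof (rule fundamental_theorem_of_calculus)
    fix x :: real
    have "((\<lambda>\<theta>. exp (\<i> * of_int k * of_real \<theta>) / (\<i> * of_int k)) has_vector_derivative
            exp (\<i> * of_int k * of_real x)) (at x within {0..2*pi})"
      by (rule has_vector_derivative_real_field derivative_eq_intros | use False in simp)+
    then show "((\<lambda>\<theta>. cis (of_int k * \<theta>) / (\<i> * of_int k)) has_vector_derivative
            cis (of_int k * x)) (at x within {0..2*pi})"
      by (simp add: cis_conv_exp mult_ac)
  qed simp
  moreover have "cis (of_int k * (2*pi)) = 1"
    using cis_multiple_2pi[of "of_int k"] by (simp add: mult_ac)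
  ultimately show ?thesis using False by simp
qed

text \<open>
  Parseval's identity for polynomials: only the diagonal products \<open>a\<^sub>m cnj a\<^sub>m\<close> survive integration.
\<close>

lemma circle_mean_polynomial:
  fixes a :: "nat \<Rightarrow> complex" and r :: real
  shows "((\<lambda>\<theta>. (cmod (\<Sum>m<M. a m * (of_real r * cis \<theta>) ^ m))\<^sup>2) has_integral
           2 * pi * (\<Sum>m<M. (cmod (a m))\<^sup>2 * (r\<^sup>2) ^ m)) {0..2*pi}"
proof -
  have prod: "complex_of_real ((cmod (\<Sum>m<M. a m * (of_real r * cis \<theta>) ^ m))\<^sup>2)
      = (\<Sum>m<M. \<Sum>l<M. a m * cnj (a l) * of_real (r ^ (m + l)) * cis (of_int (int m - int l) * \<theta>))" for \<theta>
  proof -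
    have "cis (of_int (int m - int l) * \<theta>) = cis \<theta> ^ m * cnj (cis \<theta>) ^ l" for m l
      by (simp add: Complex.DeMoivre cis_cnj cis_mult algebra_simps)
    then show ?thesis
      unfolding complex_norm_square cnj_sum sum_product
      by (intro sum.cong refl) (simp add: power_mult_distrib power_add mult_ac)
  qed
  have "((\<lambda>\<theta>. \<Sum>m<M. \<Sum>l<M. a m * cnj (a l) * of_real (r ^ (m + l)) * cis (of_int (int m - int l) * \<theta>))
      has_integral (\<Sum>m<M. \<Sum>l<M. a m * cnj (a l) * of_real (r ^ (m + l)) *
         (if int m - int l = 0 then 2 * pi else 0))) {0..2*pi}"
    by (intro has_integral_sum has_integral_mult_right has_integral_cis_multiple finite_lessThan)
  also have "(\<Sum>m<M. \<Sum>l<M. a m * cnj (a l) * of_real (r ^ (m + l)) *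
         complex_of_real (if int m - int l = 0 then 2 * pi else 0))
       = (\<Sum>m<M. \<Sum>l<M. if m = l then a m * cnj (a l) * of_real (r ^ (m + l)) * of_real (2 * pi) else 0)"
    by (intro sum.cong refl) auto
  also have "\<dots> = (\<Sum>m<M. of_real (2 * pi * ((cmod (a m))\<^sup>2 * (r\<^sup>2) ^ m)))"
    by (intro sum.cong refl)
      (simp add: complex_norm_square[symmetric] power_add power2_eq_square power_mult_distrib mult_ac)
  also have "\<dots> = of_real (2 * pi * (\<Sum>m<M. (cmod (a m))\<^sup>2 * (r\<^sup>2) ^ m))"
    by (simp add: sum_distrib_left)
  finally have "((\<lambda>\<theta>. complex_of_real ((cmod (\<Sum>m<M. a m * (of_real r * cis \<theta>) ^ m))\<^sup>2)) has_integral
           of_real (2 * pi * (\<Sum>m<M. (cmod (a m))\<^sup>2 * (r\<^sup>2) ^ m))) {0..2*pi}"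
    unfolding prod .
  from has_integral_linear[OF this bounded_linear_Re] show ?thesis
    by (simp add: o_def)
qed

text \<open>
  Parseval's identity for power series, from the polynomial case by dominated convergence: inside
  the disc of convergence the partial sums are bounded on the circle by the sum of the moduli.
\<close>

lemma circle_mean_power_series:
  fixes q :: "complex \<Rightarrow> complex" and a :: "nat \<Rightarrow> complex"
  assumes q: "\<And>z. z \<in> ball 0 R \<Longrightarrow> (\<lambda>m. a m * z ^ m) sums q z" and r: "0 \<le> r" "r < R"
  obtains S where "(\<lambda>m. (cmod (a m))\<^sup>2 * (r\<^sup>2) ^ m) sums S"
    "((\<lambda>\<theta>. (cmod (q (of_real r * cis \<theta>)))\<^sup>2) has_integral 2 * pi * S) {0..2*pi}"
proof -
  obtain r' where r': "r < r'" "r' < R" using dense r(2) by blast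
  have "summable (\<lambda>m. a m * of_real r' ^ m)"
    using q[of "of_real r'"] r r' by (auto simp: sums_iff)
  then have abs: "summable (\<lambda>m. norm (a m * of_real r ^ m))"
    using powser_insidea[of a "of_real r'" "of_real r"] r r' by simp
  define B where "B = (\<Sum>m. norm (a m * of_real r ^ m))"
  define T where "T M \<theta> = (\<Sum>m<M. a m * (of_real r * cis \<theta>) ^ m)" for M \<theta>
  define I where "I M = 2 * pi * (\<Sum>m<M. (cmod (a m))\<^sup>2 * (r\<^sup>2) ^ m)" for M
  have bound: "cmod (T M \<theta>) \<le> B" for M \<theta>
  proof -
    have "cmod (T M \<theta>) \<le> (\<Sum>m<M. norm (a m * of_real r ^ m))"
      unfolding T_def by (rule order_trans[OF norm_sum]) (simp add: norm_mult norm_power)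
    also have "\<dots> \<le> B" unfolding B_def by (rule sum_le_suminf[OF abs]) auto
    finally show ?thesis .
  qed
  have lim: "(\<lambda>M. (cmod (T M \<theta>))\<^sup>2) \<longlonglongrightarrow> (cmod (q (of_real r * cis \<theta>)))\<^sup>2" for \<theta>
  proof -
    have "of_real r * cis \<theta> \<in> ball 0 R" using r by (simp add: norm_mult)
    then have "(\<lambda>M. T M \<theta>) \<longlonglongrightarrow> q (of_real r * cis \<theta>)"
      using q unfolding T_def sums_def by blast
    then show ?thesis by (intro tendsto_intros)
  qed
  have int: "((\<lambda>\<theta>. (cmod (T M \<theta>))\<^sup>2) has_integral I M) {0..2*pi}" for M
    unfolding T_def I_def by (rule circle_mean_polynomial)
  have sq: "(cmod (T M \<theta>))\<^sup>2 \<le> B\<^sup>2" for M \<theta> by (intro power_mono bound) auto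
  note dc = dominated_convergence[of "\<lambda>M \<theta>. (cmod (T M \<theta>))\<^sup>2" "{0..2*pi}" "\<lambda>_. B\<^sup>2"
      "\<lambda>\<theta>. (cmod (q (of_real r * cis \<theta>)))\<^sup>2"]
  have io: "(\<lambda>\<theta>. (cmod (q (of_real r * cis \<theta>)))\<^sup>2) integrable_on {0..2*pi}"
    by (rule dc(1)) (use int lim sq in \<open>auto intro: has_integral_integrable\<close>)
  have "(\<lambda>M. integral {0..2*pi} (\<lambda>\<theta>. (cmod (T M \<theta>))\<^sup>2)) \<longlonglongrightarrow>
      integral {0..2*pi} (\<lambda>\<theta>. (cmod (q (of_real r * cis \<theta>)))\<^sup>2)"
    by (rule dc(2)) (use int lim sq in \<open>auto intro: has_integral_integrable\<close>)
  then have "I \<longlonglongrightarrow> integral {0..2*pi} (\<lambda>\<theta>. (cmod (q (of_real r * cis \<theta>)))\<^sup>2)"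
    unfolding integral_unique[OF int] .
  then have "(\<lambda>M. I M / (2 * pi)) \<longlonglongrightarrow>
      integral {0..2*pi} (\<lambda>\<theta>. (cmod (q (of_real r * cis \<theta>)))\<^sup>2) / (2 * pi)"
    by (intro tendsto_intros) auto
  then have "(\<lambda>m. (cmod (a m))\<^sup>2 * (r\<^sup>2) ^ m) sums
      (integral {0..2*pi} (\<lambda>\<theta>. (cmod (q (of_real r * cis \<theta>)))\<^sup>2) / (2 * pi))"
    by (simp add: I_def sums_def)
  from that[OF this] show ?thesis using io by (simp add: has_integral_integral)
qed

lemma sums_swap_nonneg:
  fixes b :: "nat \<Rightarrow> nat \<Rightarrow> real"
  assumes nn: "\<And>j m. b j m \<ge> 0" and inner: "\<And>j. b j sums S j" and outer: "S sums E"
  shows "(\<lambda>j. b j m) sums (\<Sum>j. b j m)" "(\<lambda>m. \<Sum>j. b j m) sums E"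
proof -
  have Snn: "S j \<ge> 0" for j using inner[of j] nn by (metis sums_le sums_zero)
  have le: "b j m \<le> S j" for j m
    using sum_le_suminf[of "b j" "{m}"] inner[of j] nn by (auto simp: sums_iff)
  have col: "summable (\<lambda>j. b j m)" for m
    by (rule summable_comparison_test'[of S 0]) (use outer le nn in \<open>auto simp: sums_iff\<close>)
  then show "(\<lambda>j. b j m) sums (\<Sum>j. b j m)" by (rule summable_sums)
  have hs_in: "(b j has_sum S j) UNIV" for j
    by (rule sums_nonneg_imp_has_sum) (use inner nn in auto)
  have hs_out: "(S has_sum E) UNIV"
    by (rule sums_nonneg_imp_has_sum) (use outer Snn in auto)
  have so: "(\<lambda>(j, m). b j m) summable_on (UNIV \<times> UNIV)"
    by (rule summable_on_SigmaI[where g = S]) (use hs_in hs_out nn in \<open>auto simp: has_sum_imp_summable\<close>)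
  have "((\<lambda>(j, m). b j m) has_sum E) (UNIV \<times> UNIV)"
    by (rule has_sum_SigmaI[where g = S]) (use hs_in hs_out so in auto)
  then have "((\<lambda>(m, j). b j m) has_sum E) (UNIV \<times> UNIV)"
    by (subst (asm) has_sum_swap) simp
  then have "((\<lambda>m. \<Sum>j. b j m) has_sum E) UNIV"
    by (rule has_sum_SigmaD) (use col nn in \<open>auto intro!: sums_nonneg_imp_has_sum summable_sums\<close>)
  then show "(\<lambda>m. \<Sum>j. b j m) sums E" by (rule has_sum_imp_sums)
qed

text \<open>
  Integrate the sum over the circle of radius \<open>\<surd>t\<close>.  The integral of each summand is a power series
  in \<open>t\<close> with coefficients \<open>\<bar>a\<^sub>m\<bar>\<^sup>2\<close>, while the total is constant on the circle; nonnegativity allows the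
  sums over \<open>j\<close> and \<open>m\<close> to be exchanged.
\<close>

lemma radial_sum_of_squares_power_series:
  fixes q :: "nat \<Rightarrow> complex \<Rightarrow> complex" and E :: "real \<Rightarrow> real"
  assumes R: "R > 0" and hol: "\<And>j. q j holomorphic_on ball 0 R"
    and sum: "\<And>z. z \<in> ball 0 R \<Longrightarrow> (\<lambda>j. (cmod (q j z))\<^sup>2) sums E ((cmod z)\<^sup>2)"
  obtains d where "\<And>m. d m \<ge> (0::real)" "\<And>t. t \<in> {0<..<R\<^sup>2} \<Longrightarrow> (\<lambda>m. d m * t ^ m) sums E t"
proof -
  define a where "a j m = (deriv ^^ m) (q j) 0 / fact m" for j m
  define b where "b j m = (cmod (a j m))\<^sup>2" for j m
  have ser: "(\<lambda>m. a j m * z ^ m) sums q j z" if "z \<in> ball 0 R" for j z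
    using holomorphic_power_series[OF hol that] by (simp add: a_def)
  have main: "summable (\<lambda>j. b j m) \<and> (\<lambda>m. (\<Sum>j. b j m) * t ^ m) sums E t"
    if t: "t \<in> {0<..<R\<^sup>2}" for t m
  proof -
    define r where "r = sqrt t"
    have r: "0 < r" "r < R" "r\<^sup>2 = t"
      using t R by (auto simp: r_def real_less_rsqrt intro: real_less_lsqrt)
    have "\<exists>S. (\<lambda>m. b j m * t ^ m) sums S \<and>
        ((\<lambda>\<theta>. (cmod (q j (of_real r * cis \<theta>)))\<^sup>2) has_integral 2 * pi * S) {0..2*pi}" for j
      unfolding b_def using r by (auto intro: circle_mean_power_series[OF ser, of R r j])
    then obtain S where S: "\<And>j. (\<lambda>m. b j m * t ^ m) sums S j"
      "\<And>j. ((\<lambda>\<theta>. (cmod (q j (of_real r * cis \<theta>)))\<^sup>2) has_integral 2 * pi * S j) {0..2*pi}"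
      by metis
    have zin: "of_real r * cis \<theta> \<in> ball 0 R" "cmod (of_real r * cis \<theta>) = r" for \<theta>
      using r by (auto simp: norm_mult)
    have circ: "(\<lambda>j. (cmod (q j (of_real r * cis \<theta>)))\<^sup>2) sums E t" for \<theta>
      using sum[OF zin(1)[of \<theta>]] unfolding zin(2) r(3) .
    have "((\<lambda>\<theta>. E t) has_integral E t * (2 * pi)) {0..2*pi}"
      using has_integral_const_real[of "E t" 0 "2*pi"] by (simp add: mult.commute)
    then have cint: "integral {0..2*pi} (\<lambda>\<theta>. E t) = E t * (2 * pi)" by (rule integral_unique)
    have pint: "((\<lambda>\<theta>. \<Sum>j<k. (cmod (q j (of_real r * cis \<theta>)))\<^sup>2) has_integral
        (\<Sum>j<k. 2 * pi * S j)) {0..2*pi}" for k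
      by (intro has_integral_sum S) auto
    (* The partial sums over j are dominated by the total E t, which is constant on the circle. *)
    have "(\<lambda>k. integral {0..2*pi} (\<lambda>\<theta>. \<Sum>j<k. (cmod (q j (of_real r * cis \<theta>)))\<^sup>2))
       \<longlonglongrightarrow> integral {0..2*pi} (\<lambda>\<theta>. E t)"
    proof (rule dominated_convergence(2))
      fix k x
      show "norm (\<Sum>j<k. (cmod (q j (of_real r * cis x)))\<^sup>2) \<le> E t"
        using sum_le_suminf[of "\<lambda>j. (cmod (q j (of_real r * cis x)))\<^sup>2" "{..<k}"] circ[of x]
        by (auto simp: sums_iff sum_nonneg)
    qed (use pint circ in \<open>auto simp: sums_def intro: has_integral_integrable\<close>)
    then have "(\<lambda>k. (\<Sum>j<k. 2 * pi * S j) / (2 * pi)) \<longlonglongrightarrow> E t * (2 * pi) / (2 * pi)"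
      unfolding integral_unique[OF pint] cint by (intro tendsto_intros) auto
    then have out: "S sums E t" by (simp add: sums_def flip: sum_distrib_left)
    have "b j m * t ^ m \<ge> 0" for j m using t by (simp add: b_def)
    note sw = sums_swap_nonneg[OF this S(1) out]
    have sm: "summable (\<lambda>j. b j m)" for m
    proof -
      have "summable (\<lambda>j. b j m * t ^ m)" using sw(1) by (auto simp: sums_iff)
      from summable_mult2[OF this, of "inverse (t ^ m)"] show ?thesis using t by (simp add: mult.assoc)
    qed
    then show ?thesis using sw(2) by (simp add: suminf_mult2)
  qed
  have "R\<^sup>2 / 2 \<in> {0<..<R\<^sup>2}" using R by simp
  note pos = main[OF this]
  show ?thesis
  proof (rule that[of "\<lambda>m. \<Sum>j. b j m"])
    show "(\<Sum>j. b j m) \<ge> 0" for m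
      using pos[of m] by (intro suminf_nonneg) (auto simp: b_def)
    show "(\<lambda>m. (\<Sum>j. b j m) * t ^ m) sums E t" if "t \<in> {0<..<R\<^sup>2}" for t
      using main[OF that] by blast
  qed
qed

text \<open>
  This can be iterated, so that a function with nonnegative Taylor coefficients has nonnegative
  derivatives of every order on \<open>(0, \<rho>)\<close>.
\<close>

lemma nonneg_power_series_derivative:
  fixes d :: "nat \<Rightarrow> real"
  assumes nn: "\<And>m. d m \<ge> 0" and ser: "\<And>t. t \<in> {0<..<\<rho>} \<Longrightarrow> (\<lambda>m. d m * t ^ m) sums E t"
    and der: "\<And>t. t \<in> {0<..<\<rho>} \<Longrightarrow> (E has_real_derivative E' t) (at t)"
  obtains d' where "\<And>m. d' m \<ge> (0::real)" "\<And>t. t \<in> {0<..<\<rho>} \<Longrightarrow> (\<lambda>m. d' m * t ^ m) sums E' t"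
proof (rule that[of "diffs d"])
  show "diffs d m \<ge> 0" for m using nn by (simp add: diffs_def)
  fix t assume t: "t \<in> {0<..<\<rho>}"
  then obtain K where K: "t < K" "K < \<rho>" using dense by (metis greaterThanLessThan_iff)
  have sK: "summable (\<lambda>m. d m * K ^ m)" using ser[of K] K t by (auto simp: sums_iff)
  have *: "((\<lambda>x. \<Sum>m. d m * x ^ m) has_real_derivative (\<Sum>m. diffs d m * t ^ m)) (at t)"
    by (rule termdiffs_strong[OF sK]) (use K t in auto)
  have "(E has_real_derivative (\<Sum>m. diffs d m * t ^ m)) (at t)"
    by (rule has_field_derivative_transform_within_open[OF *, of "{0<..<\<rho>}"])
      (use t ser in \<open>auto simp: sums_iff\<close>)
  then have "E' t = (\<Sum>m. diffs d m * t ^ m)" using der[OF t] by (rule DERIV_unique[symmetric])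
  moreover have "summable (\<lambda>m. diffs d m * t ^ m)"
    by (rule termdiff_converges[where K = K]) (use K t in \<open>auto intro: powser_inside[OF sK]\<close>)
  ultimately show "(\<lambda>m. diffs d m * t ^ m) sums E' t" by (simp add: summable_sums)
qed

section \<open>The Hermitian product on the sequence space\<close>

lemmas ell2_nth_simps = plus_ell2.rep_eq zero_ell2.rep_eq uminus_ell2.rep_eq ell2_scale.rep_eq

lemma ell2_scale_simps:
  "ell2_scale a (ell2_scale b x) = ell2_scale (a * b) x"
  "ell2_scale (a + b) x = ell2_scale a x + ell2_scale b x"
  "ell2_scale a (x + y) = ell2_scale a x + ell2_scale a y"
  "ell2_scale (of_real r) x = r *\<^sub>R x"
  "ell2_scale a (r *\<^sub>R x) = r *\<^sub>R ell2_scale a x"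
  "ell2_scale (r *\<^sub>R a) x = r *\<^sub>R ell2_scale a x"
  "ell2_scale 1 x = x"
  "ell2_scale 0 x = 0"
  by (rule ell2_eqI, simp add: ell2_nth_simps scaleR_ell2_def scaleR_conv_of_real algebra_simps)+

lemma inner_ell2_scale: "ell2_scale c x \<bullet> y = x \<bullet> ell2_scale (cnj c) y"
  by (simp add: inner_ell2_def ell2_nth_simps inner_complex_def algebra_simps)

text \<open>
  The Hermitian product \<open>\<Sum>\<^sub>j x\<^sub>j cnj y\<^sub>j\<close>, recovered from its real part, the inner product of
  \<open>\<ell>\<^sup>2\<close> as a real Hilbert space.
\<close>

definition hprod :: "ell2 \<Rightarrow> ell2 \<Rightarrow> complex" where
  "hprod x y = Complex (x \<bullet> y) (x \<bullet> ell2_scale \<i> y)"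

lemma Re_hprod: "Re (hprod x y) = x \<bullet> y" by (simp add: hprod_def)

lemma ell2_scale_uminus: "ell2_scale (- c) x = - ell2_scale c x"
  by (rule ell2_eqI) (simp add: ell2_nth_simps)

lemma inner_ell2_scale_i: "ell2_scale \<i> x \<bullet> y = - (x \<bullet> ell2_scale \<i> y)"
  by (simp add: inner_ell2_scale ell2_scale_uminus)

lemma ell2_scale_Complex: "ell2_scale c x = Re c *\<^sub>R x + Im c *\<^sub>R ell2_scale \<i> x"
proof -
  have "c = of_real (Re c) + Im c *\<^sub>R \<i>" by (simp add: complex_eq_iff)
  then show ?thesis by (metis ell2_scale_simps(2,4,6))
qed

lemma hprod_add_left: "hprod (x + y) z = hprod x z + hprod y z"
  by (simp add: hprod_def inner_add_left complex_eq_iff)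

lemma hprod_scale_left: "hprod (ell2_scale c x) y = c * hprod x y"
proof -
  have "ell2_scale \<i> x \<bullet> ell2_scale \<i> y = x \<bullet> y"
    by (simp add: inner_ell2_scale ell2_scale_simps)
  then show ?thesis
    by (simp add: hprod_def ell2_scale_Complex[of c x] inner_add_left inner_ell2_scale_i complex_eq_iff)
qed

lemma hprod_cnj: "cnj (hprod x y) = hprod y x"
  using inner_ell2_scale_i[of y x] by (simp add: hprod_def complex_eq_iff inner_commute)

lemma hprod_scale_right: "hprod x (ell2_scale c y) = cnj c * hprod x y"
  by (metis hprod_cnj hprod_scale_left complex_cnj_mult)

lemma hprod_add_right: "hprod x (y + z) = hprod x y + hprod x z"
  by (metis hprod_cnj hprod_add_left complex_cnj_add)

lemma hprod_self: "hprod x x = of_real ((norm x)\<^sup>2)"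
proof -
  have "x \<bullet> ell2_scale \<i> x = 0" using inner_ell2_scale_i[of x x] by (simp add: inner_commute)
  then show ?thesis by (simp add: hprod_def complex_eq_iff power2_norm_eq_inner)
qed

lemma norm_ell2_scale: "norm (ell2_scale c x) = cmod c * norm x"
proof -
  have "complex_of_real ((norm (ell2_scale c x))\<^sup>2) = of_real ((cmod c * norm x)\<^sup>2)"
    unfolding hprod_self[symmetric] hprod_scale_left hprod_scale_right
    unfolding hprod_self using complex_norm_square[of c] by (simp add: power_mult_distrib mult_ac)
  then have "(norm (ell2_scale c x))\<^sup>2 = (cmod c * norm x)\<^sup>2" by (simp only: of_real_eq_iff)
  then show ?thesis by (simp add: power2_eq_iff_nonneg)
qed

text \<open>
  Rotating \<open>x\<close> by the phase of the product reduces this to the real inequality.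
\<close>

lemma hprod_Cauchy_Schwarz: "cmod (hprod x y) \<le> norm x * norm y"
proof (cases "hprod x y = 0")
  case False
  define c where "c = cnj (sgn (hprod x y))"
  have "c * hprod x y = of_real (cmod (hprod x y))"
    using False by (simp add: c_def sgn_div_norm complex_norm_square[symmetric] power2_eq_square field_simps scaleR_conv_of_real)
  then have "cmod (hprod x y) = Re (hprod (ell2_scale c x) y)" by (simp add: hprod_scale_left)
  also have "\<dots> \<le> norm (ell2_scale c x) * norm y"
    by (simp add: Re_hprod norm_cauchy_schwarz)
  also have "\<dots> = norm x * norm y" using False by (simp add: norm_ell2_scale c_def norm_sgn)
  finally show ?thesis .
qed simp

lemma bounded_linear_hprod: "bounded_linear (\<lambda>x. hprod x y)"
proof (rule bounded_linear_intro[where K = "norm y"])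
  show "hprod (r *\<^sub>R x) y = r *\<^sub>R hprod x y" for r x
    using hprod_scale_left[of "of_real r" x y] by (simp add: ell2_scale_simps scaleR_conv_of_real)
qed (auto simp: hprod_add_left hprod_Cauchy_Schwarz)

lemma bounded_linear_ell2_scale: "bounded_linear (\<lambda>c. ell2_scale c x)"
  by (rule bounded_linear_intro[where K = "norm x"]) (auto simp: ell2_scale_simps norm_ell2_scale)

lemma bounded_linear_ell2_nth: "bounded_linear (\<lambda>x. ell2_nth x j)"
proof (rule bounded_linear_intro[where K = 1])
  fix x :: ell2
  have "(cmod (ell2_nth x j))\<^sup>2 \<le> (norm x)\<^sup>2"
    unfolding norm_ell2_power2
    using sum_le_suminf[OF ell2_summable[of x], of "{j}"] by simp
  then show "norm (ell2_nth x j) \<le> norm x * 1" by (simp add: power2_le_iff_abs_le)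
qed (auto simp: ell2_nth_simps scaleR_ell2_def scaleR_conv_of_real)

section \<open>Mixed derivatives along complex lines\<close>

lemma has_vector_derivative_line:
  fixes h :: "complex \<Rightarrow> complex"
  assumes "(h has_derivative D) (at s)"
  shows "vector_derivative (\<lambda>t::real. h (s + w * of_real t)) (at 0) = D w"
proof (rule vector_derivative_at)
  have l: "linear D" using assms has_derivative_linear by blast
  have "((\<lambda>t. s + w * of_real t) has_derivative (\<lambda>t. w * of_real t)) (at 0)"
    by (auto intro!: derivative_eq_intros)
  from has_derivative_compose[OF this, of h D] assms
  have "((\<lambda>t. h (s + w * of_real t)) has_derivative (\<lambda>t. D (w * of_real t))) (at 0)" by simp
  moreover have "D (w * of_real t) = t *\<^sub>R D w" for t
    using linear_scale[OF l, of t w] by (simp add: scaleR_conv_of_real mult.commute)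
  ultimately show "((\<lambda>t. h (s + w * of_real t)) has_vector_derivative D w) (at 0)"
    by (simp add: has_vector_derivative_def)
qed

lemma wirtinger_eq:
  assumes "(h has_derivative D) (at s)"
  shows "wirtinger h s = (D 1 - \<i> * D \<i>) / 2" "wirtinger_bar h s = (D 1 + \<i> * D \<i>) / 2"
  using has_vector_derivative_line[OF assms, of 1] has_vector_derivative_line[OF assms, of \<i>]
  by (simp_all add: wirtinger_def wirtinger_bar_def)

text \<open>
  When the two directions agree, the Hessian is \<open>\<partial>\<^sup>2/\<partial>\<tau> \<partial>(cnj \<tau>)\<close> of the restriction of the
  function to the complex line, and it can be computed in two steps: \<open>B\<close> is the first derivative
  \<open>\<partial>/\<partial>(cnj \<tau>)\<close> in a neighbourhood, and \<open>D'\<close> is the real differential of \<open>B\<close>.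
\<close>

lemma complex_hessian_line:
  assumes lin: "\<And>s t. x + scl s u + scl t u = x + scl (s + t) u"
    and S: "open S" "0 \<in> S"
    and D: "\<And>\<tau>. \<tau> \<in> S \<Longrightarrow> ((\<lambda>\<tau>. of_real (\<phi> (x + scl \<tau> u))) has_derivative D \<tau>) (at \<tau>)"
    and B: "\<And>\<tau>. \<tau> \<in> S \<Longrightarrow> (D \<tau> 1 + \<i> * D \<tau> \<i>) / 2 = B \<tau>"
    and D': "(B has_derivative D') (at 0)"
  shows "complex_hessian scl \<phi> x u u = (D' 1 - \<i> * D' \<i>) / 2"
proof -
  define P where "P \<tau> = complex_of_real (\<phi> (x + scl \<tau> u))" for \<tau>
  have shift: "wirtinger_bar (\<lambda>t. P (s + t)) 0 = wirtinger_bar P s" for s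
    by (simp add: wirtinger_bar_def)
  have "complex_hessian scl \<phi> x u u = wirtinger (\<lambda>s. wirtinger_bar (\<lambda>t. P (s + t)) 0) 0"
    unfolding complex_hessian_def lin P_def ..
  also have "\<dots> = wirtinger (wirtinger_bar P) 0" unfolding shift ..
  also have "(wirtinger_bar P has_derivative D') (at 0)"
  proof (rule has_derivative_transform_within_open[OF D' S])
    fix \<tau> assume "\<tau> \<in> S"
    then show "B \<tau> = wirtinger_bar P \<tau>"
      using wirtinger_eq(2)[of P "D \<tau>" \<tau>] D B by (simp add: P_def[abs_def])
  qed
  then have "wirtinger (wirtinger_bar P) 0 = (D' 1 - \<i> * D' \<i>) / 2" by (rule wirtinger_eq)
  finally show ?thesis .
qed

text \<open>
  The squared Fubini--Study length of a tangent vector in an affine chart.  By the Cauchy--Schwarz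
  inequality it is at least \<open>\<parallel>u\<parallel>\<^sup>2 / (1 + \<parallel>\<zeta>\<parallel>\<^sup>2)\<^sup>2\<close>, so it controls the norm of \<open>u\<close>.
\<close>

lemma fubini_study_diagonal:
  "fubini_study \<zeta> u u =
     of_real (((norm u)\<^sup>2 * (1 + (norm \<zeta>)\<^sup>2) - (cmod (hprod u \<zeta>))\<^sup>2) / (1 + (norm \<zeta>)\<^sup>2)\<^sup>2)"
proof -
  define Z where "Z \<tau> = \<zeta> + ell2_scale \<tau> u" for \<tau>
  define n where "n \<tau> = 1 + Z \<tau> \<bullet> Z \<tau>" for \<tau>
  have npos: "n \<tau> > 0" for \<tau> by (simp add: n_def add_pos_nonneg)
  have Z: "(Z has_derivative (\<lambda>d. ell2_scale d u)) (at \<tau>)" for \<tau>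
    unfolding Z_def by (auto intro!: derivative_eq_intros bounded_linear.has_derivative[OF bounded_linear_ell2_scale])
  have n: "(n has_derivative (\<lambda>d. 2 * (Z \<tau> \<bullet> ell2_scale d u))) (at \<tau>)" for \<tau>
    unfolding n_def by (auto intro!: derivative_eq_intros Z simp: inner_commute)
  have ln: "((\<lambda>\<tau>. complex_of_real (ln (n \<tau>))) has_derivative
       (\<lambda>d. of_real (2 * (Z \<tau> \<bullet> ell2_scale d u) / n \<tau>))) (at \<tau>)" for \<tau>
    using npos[of \<tau>] by (auto intro!: derivative_eq_intros n simp: divide_inverse mult_ac)
  have Bd: "((\<lambda>\<tau>. hprod (Z \<tau>) u / of_real (n \<tau>)) has_derivative
      (\<lambda>d. d * of_real ((norm u)\<^sup>2) / of_real (n 0)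
         - hprod \<zeta> u * of_real (2 * (\<zeta> \<bullet> ell2_scale d u)) / (of_real (n 0))\<^sup>2)) (at 0)"
  proof -
    have "Z 0 = \<zeta>" by (simp add: Z_def ell2_scale_simps)
    moreover have "((\<lambda>\<tau>. hprod (Z \<tau>) u / of_real (n \<tau>)) has_derivative
      (\<lambda>d. (hprod (ell2_scale d u) u * of_real (n 0) - hprod (Z 0) u * of_real (2 * (Z 0 \<bullet> ell2_scale d u)))
          / (of_real (n 0) * of_real (n 0)))) (at 0)"
      using npos[of 0]
      by (intro has_derivative_divide' has_derivative_of_real[OF n] bounded_linear.has_derivative[OF bounded_linear_hprod Z])
        simp
    ultimately show ?thesis
      using npos[of 0]
      by (simp add: hprod_scale_left hprod_self diff_divide_distrib power2_eq_square)
  qed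
  have "fubini_study \<zeta> u u = complex_hessian ell2_scale (\<lambda>\<zeta>. ln (1 + (norm \<zeta>)\<^sup>2)) \<zeta> u u"
    by (simp add: fubini_study_def norm_ell2_power2)
  also have "\<dots> = ((1 * of_real ((norm u)\<^sup>2) / of_real (n 0)
         - hprod \<zeta> u * of_real (2 * (\<zeta> \<bullet> ell2_scale 1 u)) / (of_real (n 0))\<^sup>2)
        - \<i> * (\<i> * of_real ((norm u)\<^sup>2) / of_real (n 0)
         - hprod \<zeta> u * of_real (2 * (\<zeta> \<bullet> ell2_scale \<i> u)) / (of_real (n 0))\<^sup>2)) / 2"
  proof (rule complex_hessian_line[OF _ open_UNIV _ _ _ Bd])
    show "((\<lambda>\<tau>. complex_of_real (ln (1 + (norm (\<zeta> + ell2_scale \<tau> u))\<^sup>2))) has_derivative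
       (\<lambda>d. of_real (2 * (Z \<tau> \<bullet> ell2_scale d u) / n \<tau>))) (at \<tau>)" for \<tau>
      using ln[of \<tau>] by (simp add: n_def Z_def power2_norm_eq_inner)
    show "(of_real (2 * (Z \<tau> \<bullet> ell2_scale 1 u) / n \<tau>) + \<i> * of_real (2 * (Z \<tau> \<bullet> ell2_scale \<i> u) / n \<tau>)) / 2
       = hprod (Z \<tau>) u / of_real (n \<tau>)" for \<tau>
      by (simp add: hprod_def complex_eq_iff ell2_scale_simps)
  qed (auto simp: ell2_scale_simps add.assoc)
  also have "\<dots> = of_real ((norm u)\<^sup>2) / of_real (n 0)
      - hprod \<zeta> u * cnj (hprod \<zeta> u) / (of_real (n 0))\<^sup>2"
  proof -
    have *: "cnj (hprod \<zeta> u) = of_real (\<zeta> \<bullet> ell2_scale 1 u) - \<i> * of_real (\<zeta> \<bullet> ell2_scale \<i> u)"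
      by (simp add: hprod_def complex_eq_iff ell2_scale_simps)
    show ?thesis unfolding * by (simp add: algebra_simps add_divide_distrib diff_divide_distrib)
  qed
  also have "hprod \<zeta> u * cnj (hprod \<zeta> u) = of_real ((cmod (hprod u \<zeta>))\<^sup>2)"
    by (metis complex_mod_cnj complex_norm_square hprod_cnj)
  also have "n 0 = 1 + (norm \<zeta>)\<^sup>2" by (simp add: n_def Z_def ell2_scale_simps power2_norm_eq_inner)
  also have "complex_of_real ((norm u)\<^sup>2) / of_real (1 + (norm \<zeta>)\<^sup>2)
      - of_real ((cmod (hprod u \<zeta>))\<^sup>2) / (of_real (1 + (norm \<zeta>)\<^sup>2))\<^sup>2
    = of_real ((norm u)\<^sup>2 / (1 + (norm \<zeta>)\<^sup>2) - (cmod (hprod u \<zeta>))\<^sup>2 / (1 + (norm \<zeta>)\<^sup>2)\<^sup>2)"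
    by simp
  also have "(norm u)\<^sup>2 / (1 + (norm \<zeta>)\<^sup>2) - (cmod (hprod u \<zeta>))\<^sup>2 / (1 + (norm \<zeta>)\<^sup>2)\<^sup>2
    = ((norm u)\<^sup>2 * (1 + (norm \<zeta>)\<^sup>2) - (cmod (hprod u \<zeta>))\<^sup>2) / (1 + (norm \<zeta>)\<^sup>2)\<^sup>2"
  proof -
    have "1 + (norm \<zeta>)\<^sup>2 \<noteq> 0" by (metis add_pos_nonneg less_numeral_extra(1,3) zero_le_power2)
    then show ?thesis by (simp add: diff_divide_distrib power2_eq_square)
  qed
  finally show ?thesis .
qed

text \<open>
  In Wirtinger notation, \<open>\<partial>/\<partial>s\<close> of the radial potential is \<open>g(1 + \<bar>s\<bar>\<^sup>2) cnj s\<close>.  The one-sided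
  derivative of \<open>f\<close> at \<open>1\<close> suffices because \<open>1 + \<bar>s\<bar>\<^sup>2 \<ge> 1\<close>.
\<close>

lemma radial_potential_has_derivative:
  fixes f g :: "real \<Rightarrow> real"
  assumes f: "\<And>y. y \<ge> 1 \<Longrightarrow> (f has_real_derivative g y) (at y within {1..})"
  shows "((\<lambda>s. f (1 + (cmod s)\<^sup>2)) has_derivative (\<lambda>d. 2 * Re (of_real (g (1 + (cmod s)\<^sup>2)) * cnj s * d))) (at s)"
proof -
  have n: "((\<lambda>s. 1 + (cmod s)\<^sup>2) has_derivative (\<lambda>d. 2 * (s \<bullet> d))) (at s)"
    unfolding power2_norm_eq_inner by (auto intro!: derivative_eq_intros simp: inner_commute)
  have "(f has_derivative (\<lambda>h. g (1 + (cmod s)\<^sup>2) * h)) (at (1 + (cmod s)\<^sup>2) within range (\<lambda>s. 1 + (cmod s)\<^sup>2))"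
    using f[of "1 + (cmod s)\<^sup>2"] unfolding has_field_derivative_def
    by (auto intro: has_derivative_subset)
  from has_derivative_in_compose[OF n this]
  show ?thesis by (simp add: inner_complex_def algebra_simps)
qed

text \<open>
  The coefficient of \<open>cnj d\<close> is the mixed second derivative of the radial potential.
\<close>

lemma radial_gradient_has_derivative:
  fixes g g' :: "real \<Rightarrow> real"
  assumes g: "\<And>y. y \<ge> 1 \<Longrightarrow> (g has_real_derivative g' y) (at y)"
  shows "((\<lambda>s. of_real (g (1 + (cmod s)\<^sup>2)) * cnj s) has_derivative
    (\<lambda>d. of_real (g' (1 + (cmod s)\<^sup>2)) * (cnj s)\<^sup>2 * d
       + of_real (g (1 + (cmod s)\<^sup>2) + (cmod s)\<^sup>2 * g' (1 + (cmod s)\<^sup>2)) * cnj d)) (at s)"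
proof -
  have n: "((\<lambda>s. 1 + (cmod s)\<^sup>2) has_derivative (\<lambda>d. 2 * (s \<bullet> d))) (at s)"
    unfolding power2_norm_eq_inner by (auto intro!: derivative_eq_intros simp: inner_commute)
  have "(g has_derivative (\<lambda>h. g' (1 + (cmod s)\<^sup>2) * h)) (at (1 + (cmod s)\<^sup>2))"
    using g[of "1 + (cmod s)\<^sup>2"] unfolding has_field_derivative_def by simp
  from has_derivative_compose[OF n this]
  have "((\<lambda>s. complex_of_real (g (1 + (cmod s)\<^sup>2)) * cnj s) has_derivative
    (\<lambda>d. of_real (g (1 + (cmod s)\<^sup>2)) * cnj d + of_real (g' (1 + (cmod s)\<^sup>2) * (2 * (s \<bullet> d))) * cnj s)) (at s)"
    by (intro has_derivative_mult has_derivative_of_real has_derivative_cnj has_derivative_ident)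
  moreover have "of_real (2 * (s \<bullet> d)) = s * cnj d + cnj s * d" for d
    by (simp add: inner_complex_def complex_eq_iff)
  moreover have "complex_of_real ((cmod s)\<^sup>2) = s * cnj s" by (rule complex_norm_square)
  ultimately show ?thesis
    by (simp only: of_real_mult of_real_add) (simp add: algebra_simps power2_eq_square)
qed

text \<open>
  With \<open>t = \<bar>s\<bar>\<^sup>2\<close> this is the value \<open>g + t g'\<close> at \<open>1 + t\<close>, that is \<open>(t f'(1 + t))'\<close>.
\<close>

lemma radial_hessian:
  fixes f g g' :: "real \<Rightarrow> real"
  assumes lin: "\<And>s t. x + scl s u + scl t u = x + scl (s + t) u"
    and f: "\<And>y. y \<ge> 1 \<Longrightarrow> (f has_real_derivative g y) (at y within {1..})"
    and g: "\<And>y. y \<ge> 1 \<Longrightarrow> (g has_real_derivative g' y) (at y)"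
    and S: "open S" "0 \<in> S"
    and \<phi>: "\<And>\<tau>. \<tau> \<in> S \<Longrightarrow> \<phi> (x + scl \<tau> u) = f (1 + (cmod (s + \<tau>))\<^sup>2)"
  shows "complex_hessian scl \<phi> x u u = of_real (g (1 + (cmod s)\<^sup>2) + (cmod s)\<^sup>2 * g' (1 + (cmod s)\<^sup>2))"
proof -
  define L where "L = g (1 + (cmod s)\<^sup>2) + (cmod s)\<^sup>2 * g' (1 + (cmod s)\<^sup>2)"
  define Q where "Q = of_real (g' (1 + (cmod s)\<^sup>2)) * (cnj s)\<^sup>2"
  have sh: "((\<lambda>\<tau>. s + \<tau>) has_derivative (\<lambda>d. d)) (at \<tau>)" for \<tau>
    by (auto intro!: derivative_eq_intros)
  have "complex_hessian scl \<phi> x u u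
     = ((cnj (Q * 1 + of_real L * cnj 1)) - \<i> * (cnj (Q * \<i> + of_real L * cnj \<i>))) / 2"
  proof (rule complex_hessian_line[where scl = scl and x = x and u = u and S = S, OF lin S])
    let ?D = "\<lambda>\<tau> d. complex_of_real (2 * Re (of_real (g (1 + (cmod (s + \<tau>))\<^sup>2)) * cnj (s + \<tau>) * d))"
    let ?B = "\<lambda>\<tau>. cnj (of_real (g (1 + (cmod (s + \<tau>))\<^sup>2)) * cnj (s + \<tau>))"
    fix \<tau> assume \<tau>: "\<tau> \<in> S"
    have "((\<lambda>\<tau>. complex_of_real (f (1 + (cmod (s + \<tau>))\<^sup>2))) has_derivative ?D \<tau>) (at \<tau>)"
      by (rule has_derivative_of_real
          has_derivative_compose[OF sh, of "\<lambda>s. f (1 + (cmod s)\<^sup>2)", OF radial_potential_has_derivative[OF f]])+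
    then show "((\<lambda>\<tau>. complex_of_real (\<phi> (x + scl \<tau> u))) has_derivative ?D \<tau>) (at \<tau>)"
      by (rule has_derivative_transform_within_open[OF _ S(1) \<tau>]) (simp add: \<phi>)
    show "(?D \<tau> 1 + \<i> * ?D \<tau> \<i>) / 2 = ?B \<tau>"
      by (simp add: complex_eq_iff algebra_simps)
  next
    show "((\<lambda>\<tau>. cnj (of_real (g (1 + (cmod (s + \<tau>))\<^sup>2)) * cnj (s + \<tau>))) has_derivative
        (\<lambda>d. cnj (Q * d + of_real L * cnj d))) (at 0)"
      using has_derivative_cnj[OF has_derivative_compose[OF sh[of 0],
          of "\<lambda>s. of_real (g (1 + (cmod s)\<^sup>2)) * cnj s", OF radial_gradient_has_derivative[OF g]]]
      unfolding Q_def L_def by simp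
  qed
  also have "\<dots> = of_real L" by (simp add: complex_eq_iff)
  finally show ?thesis unfolding L_def .
qed

section \<open>From equal metrics to sums of squares\<close>

lemma hprod_curve_has_field_derivative:
  assumes H: "(H has_derivative (\<lambda>d. ell2_scale d H')) (at s)"
  shows "((\<lambda>s. hprod (H s) y) has_field_derivative hprod H' y) (at s)"
proof -
  have "(*) (hprod H' y) = (\<lambda>d. hprod (ell2_scale d H') y)"
    by (auto simp: hprod_scale_left mult.commute)
  then show ?thesis
    unfolding has_field_derivative_def
    using bounded_linear.has_derivative[OF bounded_linear_hprod H, of y] by simp
qed

text \<open>
  The product of the velocity with a fixed vector is the derivative of a scalar holomorphic
  function, hence differentiable.  This weak statement replaces second derivatives of the
  \<open>\<ell>\<^sup>2\<close>-valued curve.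
\<close>

lemma hprod_velocity_field_differentiable:
  assumes S: "open S" "s0 \<in> S"
    and H: "\<And>s. s \<in> S \<Longrightarrow> (H has_derivative (\<lambda>d. ell2_scale d (H' s))) (at s)"
  obtains l where "((\<lambda>s. hprod (H' s) y) has_field_derivative l) (at s0)"
proof -
  let ?F = "\<lambda>s. hprod (H s) y"
  have dF: "(?F has_field_derivative hprod (H' s) y) (at s)" if "s \<in> S" for s
    using hprod_curve_has_field_derivative[OF H[OF that]] .
  then have hol: "?F holomorphic_on S"
    unfolding holomorphic_on_open[OF S(1)] by blast
  have "(deriv ?F has_field_derivative deriv (deriv ?F) s0) (at s0)"
    using holomorphic_deriv[OF hol S(1)] S holomorphic_derivI by blast
  then have "((\<lambda>s. hprod (H' s) y) has_field_derivative deriv (deriv ?F) s0) (at s0)"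
    by (rule has_field_derivative_transform_within_open[OF _ S]) (use dF DERIV_imp_deriv in blast)
  then show ?thesis using that by blast
qed

text \<open>
  Expanding \<open>H(s)\<close> to first order in the second argument leaves two products of \<open>H'(s)\<close> with fixed
  vectors, which are holomorphic in \<open>s\<close>, and the product of \<open>H'(s)\<close> with the remainder.  The latter is
  \<open>o(s - s\<^sub>0)\<close> as soon as \<open>H'\<close> is bounded near \<open>s\<^sub>0\<close>.
\<close>

lemma hprod_velocity_position_has_derivative:
  assumes S: "open S" "s0 \<in> S"
    and H: "\<And>s. s \<in> S \<Longrightarrow> (H has_derivative (\<lambda>d. ell2_scale d (H' s))) (at s)"
    and bd: "eventually (\<lambda>s. norm (H' s) \<le> M) (at s0)"
  obtains l where "((\<lambda>s. hprod (H' s) (H s)) has_derivative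
      (\<lambda>d. l * d + of_real ((norm (H' s0))\<^sup>2) * cnj d)) (at s0)"
proof -
  obtain l where l: "((\<lambda>s. hprod (H' s) (H s0)) has_field_derivative l) (at s0)"
    using hprod_velocity_field_differentiable[OF S H] by blast
  obtain m where m: "((\<lambda>s. hprod (H' s) (H' s0)) has_field_derivative m) (at s0)"
    using hprod_velocity_field_differentiable[OF S H] by blast
  define \<rho> where "\<rho> s = H s - H s0 - ell2_scale (s - s0) (H' s0)" for s
  have dec: "hprod (H' s) (H s)
      = hprod (H' s) (H s0) + cnj (s - s0) * hprod (H' s) (H' s0) + hprod (H' s) (\<rho> s)" for s
  proof -
    have "H s = H s0 + ell2_scale (s - s0) (H' s0) + \<rho> s" by (simp add: \<rho>_def)
    then have "hprod (H' s) (H s) = hprod (H' s) (H s0 + ell2_scale (s - s0) (H' s0) + \<rho> s)" by simp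
    then show ?thesis by (simp only: hprod_add_right hprod_scale_right)
  qed
  have d2: "((\<lambda>s. cnj (s - s0) * hprod (H' s) (H' s0)) has_derivative
      (\<lambda>d. cnj (s0 - s0) * (m * d) + cnj (d - 0) * hprod (H' s0) (H' s0))) (at s0)"
    using m unfolding has_field_derivative_def
    by (intro has_derivative_mult has_derivative_cnj has_derivative_diff has_derivative_ident
        has_derivative_const)
  have d3: "((\<lambda>s. hprod (H' s) (\<rho> s)) has_derivative (\<lambda>d. 0)) (at s0)"
  proof -
    have lim: "((\<lambda>s. norm (\<rho> s) / norm (s - s0)) \<longlongrightarrow> 0) (at s0)"
      using H[OF S(2)] unfolding has_derivative_iff_norm \<rho>_def by simp
    have "((\<lambda>s. M * (norm (\<rho> s) / norm (s - s0))) \<longlongrightarrow> 0) (at s0)"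
      using tendsto_mult_right_zero[OF lim] .
    moreover have "eventually (\<lambda>s. norm (norm (hprod (H' s) (\<rho> s)) / norm (s - s0))
        \<le> M * (norm (\<rho> s) / norm (s - s0))) (at s0)"
      using bd
    proof eventually_elim
      case (elim s)
      have "norm (hprod (H' s) (\<rho> s)) \<le> M * norm (\<rho> s)"
        using hprod_Cauchy_Schwarz[of "H' s" "\<rho> s"] elim
        by (meson mult_right_mono norm_ge_zero order_trans)
      then show ?case by (simp add: divide_right_mono)
    qed
    ultimately have "((\<lambda>s. norm (hprod (H' s) (\<rho> s)) / norm (s - s0)) \<longlongrightarrow> 0) (at s0)"
      by (rule Lim_null_comparison[rotated])
    moreover have "hprod (H' s0) (\<rho> s0) = 0"
      using hprod_scale_right[of "H' s0" 0 "H' s0"] by (simp add: \<rho>_def ell2_scale_simps)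
    ultimately show ?thesis unfolding has_derivative_iff_norm by simp
  qed
  have "((\<lambda>s. hprod (H' s) (H s)) has_derivative
      (\<lambda>d. l * d + (cnj (s0 - s0) * (m * d) + cnj (d - 0) * hprod (H' s0) (H' s0)) + 0)) (at s0)"
    unfolding dec using l unfolding has_field_derivative_def
    by (intro has_derivative_add d2 d3)
  then show ?thesis using that[of l] by (simp add: hprod_self mult.commute)
qed

text \<open>
  Here \<open>P\<close> and \<open>L\<close> are the first and the mixed second derivative of the potential \<open>v\<close>.  Let \<open>n\<close> be
  \<open>1 + \<parallel>H\<parallel>\<^sup>2\<close>.  The difference \<open>ln n - v\<close> has \<open>\<partial>/\<partial>s\<close>-derivative \<open>W\<close>, and equality of
  the metrics says exactly that \<open>W\<close> satisfies the Cauchy--Riemann equation.  Its primitive \<open>G\<close> on the disc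
  therefore satisfies \<open>ln n - v = 2 Re G + C\<close>, and \<open>exp v\<close> equals \<open>n\<close> times the squared modulus of
  \<open>k = exp (-G - C/2)\<close>.  The functions \<open>q\<^sub>j\<close> are \<open>k\<close> and its products with the coordinates of \<open>H\<close>.
\<close>

lemma potential_sum_of_squares:
  fixes H H' :: "complex \<Rightarrow> ell2" and v L :: "complex \<Rightarrow> real" and P Q :: "complex \<Rightarrow> complex"
  assumes H: "\<And>s. s \<in> ball 0 R \<Longrightarrow> (H has_derivative (\<lambda>d. ell2_scale d (H' s))) (at s)"
    and metric: "\<And>s. s \<in> ball 0 R \<Longrightarrow> fubini_study (H s) (H' s) (H' s) = of_real (L s)"
    and v: "\<And>s. (v has_derivative (\<lambda>d. 2 * Re (P s * d))) (at s)"
    and P: "\<And>s. (P has_derivative (\<lambda>d. Q s * d + of_real (L s) * cnj d)) (at s)"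
    and L: "continuous_on (ball 0 R) L"
  obtains q :: "nat \<Rightarrow> complex \<Rightarrow> complex" where "\<And>j. q j holomorphic_on ball 0 R"
    "\<And>s. s \<in> ball 0 R \<Longrightarrow> (\<lambda>j. (cmod (q j s))\<^sup>2) sums exp (v s)"
proof -
  let ?D = "ball (0::complex) R"
  define n where "n s = 1 + (norm (H s))\<^sup>2" for s
  define K where "K s = hprod (H' s) (H s)" for s
  define W where "W s = K s / of_real (n s) - P s" for s
  have npos: "n s > 0" for s by (simp add: n_def add_pos_nonneg)
  have met: "(norm (H' s))\<^sup>2 * n s - (cmod (K s))\<^sup>2 = L s * (n s)\<^sup>2" if "s \<in> ?D" for s
  proof -
    have "((norm (H' s))\<^sup>2 * n s - (cmod (K s))\<^sup>2) / (n s)\<^sup>2 = L s"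
      using metric[OF that] unfolding fubini_study_diagonal n_def K_def by (simp only: of_real_eq_iff)
    then show ?thesis using npos[of s] by (simp add: field_simps)
  qed
  have nd: "(n has_derivative (\<lambda>d. 2 * Re (K s * d))) (at s)" if "s \<in> ?D" for s
  proof -
    have "(n has_derivative (\<lambda>d. 2 * (ell2_scale d (H' s) \<bullet> H s))) (at s)"
      unfolding n_def power2_norm_eq_inner
      using H[OF that] by (auto intro!: derivative_eq_intros simp: inner_commute)
    then show ?thesis
      by (simp add: K_def mult.commute flip: Re_hprod hprod_scale_left)
  qed
  (* The metric itself bounds the velocity: by the Cauchy-Schwarz inequality and the identity above,
     the squared norm of H' is at most L n^2, which is continuous. *)
  have bd: "\<exists>M. eventually (\<lambda>s. norm (H' s) \<le> M) (at s0)" if s0: "s0 \<in> ?D" for s0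
  proof -
    have "isCont n s0" using nd[OF s0] has_derivative_continuous by blast
    moreover have "isCont L s0" using L s0 by (simp add: continuous_on_eq_continuous_at)
    ultimately have "((\<lambda>s. L s * (n s)\<^sup>2) \<longlongrightarrow> L s0 * (n s0)\<^sup>2) (at s0)"
      unfolding isCont_def by (intro tendsto_intros)
    then have "eventually (\<lambda>s. L s * (n s)\<^sup>2 < L s0 * (n s0)\<^sup>2 + 1) (at s0)"
      by (rule order_tendstoD) simp
    moreover have "eventually (\<lambda>s. s \<in> ?D) (at s0)"
      using s0 by (intro eventually_at_in_open') auto
    ultimately have "eventually (\<lambda>s. norm (H' s) \<le> sqrt (L s0 * (n s0)\<^sup>2 + 1)) (at s0)"
    proof eventually_elim
      case (elim s)
      have "(cmod (K s))\<^sup>2 \<le> (norm (H' s) * norm (H s))\<^sup>2"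
        unfolding K_def by (intro power_mono hprod_Cauchy_Schwarz) auto
      then have "(norm (H' s))\<^sup>2 \<le> (norm (H' s))\<^sup>2 * n s - (cmod (K s))\<^sup>2"
        by (simp add: n_def algebra_simps)
      then show ?case using met[OF elim(2)] elim(1) by (simp add: real_le_rsqrt)
    qed
    then show ?thesis by blast
  qed
  have Wd: "W field_differentiable (at s)" if s: "s \<in> ?D" for s
  proof -
    obtain M where M: "eventually (\<lambda>s. norm (H' s) \<le> M) (at s)" using bd[OF s] by blast
    obtain l where l: "(K has_derivative (\<lambda>d. l * d + of_real ((norm (H' s))\<^sup>2) * cnj d)) (at s)"
      unfolding K_def[abs_def]
      by (rule hprod_velocity_position_has_derivative[OF open_ball s H M])
    have "(W has_derivative (\<lambda>d. ((l * d + of_real ((norm (H' s))\<^sup>2) * cnj d) * of_real (n s)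
         - K s * of_real (2 * Re (K s * d))) / (of_real (n s) * of_real (n s))
         - (Q s * d + of_real (L s) * cnj d))) (at s)"
      unfolding W_def[abs_def] using npos[of s]
      by (intro has_derivative_diff P has_derivative_divide' l has_derivative_of_real nd s) simp
    also have "(\<lambda>d. ((l * d + of_real ((norm (H' s))\<^sup>2) * cnj d) * of_real (n s)
         - K s * of_real (2 * Re (K s * d))) / (of_real (n s) * of_real (n s))
         - (Q s * d + of_real (L s) * cnj d))
      = (*) ((l * of_real (n s) - K s * K s) / (of_real (n s) * of_real (n s)) - Q s)"
    proof
      fix d
      have N: "complex_of_real (n s) \<noteq> 0" using npos[of s] by simp
      have re: "complex_of_real (2 * Re (K s * d)) = K s * d + cnj (K s) * cnj d"
        by (simp add: complex_eq_iff)
      (* Equality of the metrics, which cancels the coefficient of cnj d. *)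
      have "of_real ((norm (H' s))\<^sup>2 * n s - (cmod (K s))\<^sup>2) = complex_of_real (L s * (n s)\<^sup>2)"
        using met[OF s] by simp
      then have m: "of_real (L s) = (of_real ((norm (H' s))\<^sup>2) * of_real (n s) - K s * cnj (K s))
          / (complex_of_real (n s) * of_real (n s))"
        using N unfolding of_real_diff of_real_mult complex_norm_square
        by (simp add: power2_eq_square field_simps)
      show "((l * d + of_real ((norm (H' s))\<^sup>2) * cnj d) * of_real (n s)
         - K s * of_real (2 * Re (K s * d))) / (of_real (n s) * of_real (n s))
         - (Q s * d + of_real (L s) * cnj d)
        = ((l * of_real (n s) - K s * K s) / (of_real (n s) * of_real (n s)) - Q s) * d"
        unfolding re m by (simp add: add_divide_distrib diff_divide_distrib algebra_simps)
    qed
    finally show ?thesis unfolding field_differentiable_def has_field_derivative_def by blast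
  qed
  have "W holomorphic_on ?D"
    using Wd field_differentiable_at_within holomorphic_on_def by blast
  then obtain G where G: "\<And>s. s \<in> ?D \<Longrightarrow> (G has_field_derivative W s) (at s within ?D)"
    using holomorphic_convex_primitive'[OF convex_ball open_ball] by blast
  have Gd: "(G has_field_derivative W s) (at s)" if "s \<in> ?D" for s
    using G[OF that] at_within_open[OF that open_ball] by simp
  have "((\<lambda>s. ln (n s) - v s - 2 * Re (G s)) has_derivative (\<lambda>d. 0)) (at s within ?D)"
    if s: "s \<in> ?D" for s
  proof -
    have "((\<lambda>s. ln (n s) - v s - 2 * Re (G s)) has_derivative
       (\<lambda>d. 2 * Re (K s * d) * inverse (n s) - 2 * Re (P s * d) - 2 * Re (W s * d))) (at s)"
      using Gd[OF s] npos[of s] unfolding has_field_derivative_def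
      by (intro has_derivative_diff has_derivative_mult_right has_derivative_Re v
          has_derivative_ln nd s)
    moreover have "2 * Re (K s * d) * inverse (n s) - 2 * Re (P s * d) - 2 * Re (W s * d) = 0" for d
    proof -
      have "W s * d = of_real (inverse (n s)) * (K s * d) - P s * d"
        by (simp add: W_def field_simps)
      moreover have "Re (of_real a * z) = a * Re z" for a z by simp
      ultimately have re: "Re (W s * d) = inverse (n s) * Re (K s * d) - Re (P s * d)"
        by (simp only: minus_complex.simps)
      have "2 * x * a - 2 * y - 2 * (a * x - y) = 0" for x y a :: real
        by (simp add: algebra_simps)
      then show ?thesis unfolding re .
    qed
    ultimately have "((\<lambda>s. ln (n s) - v s - 2 * Re (G s)) has_derivative (\<lambda>d. 0)) (at s)"
      by (simp only:)
    then show ?thesis by (rule has_derivative_at_withinI)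
  qed
  then obtain C where C: "\<And>s. s \<in> ?D \<Longrightarrow> ln (n s) - v s - 2 * Re (G s) = C"
    using has_derivative_zero_constant[OF convex_ball, of 0 R "\<lambda>s. ln (n s) - v s - 2 * Re (G s)"]
    by blast
  define k where "k s = exp (- G s - of_real (C / 2))" for s
  have k2: "(cmod (k s))\<^sup>2 * n s = exp (v s)" if "s \<in> ?D" for s
  proof -
    have "(cmod (k s))\<^sup>2 = exp (- 2 * Re (G s) - C)"
      by (simp add: k_def power2_eq_square flip: exp_add)
    then have "(cmod (k s))\<^sup>2 * n s = exp (- 2 * Re (G s) - C + ln (n s))"
      using npos[of s] by (simp add: exp_add)
    also have "- 2 * Re (G s) - C + ln (n s) = v s" using C[OF that] by simp
    finally show ?thesis .
  qed
  define q where "q j s = (case j of 0 \<Rightarrow> k s | Suc i \<Rightarrow> k s * ell2_nth (H s) i)" for j s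
  show ?thesis
  proof (rule that[of q])
    have "G holomorphic_on ?D"
      unfolding holomorphic_on_open[OF open_ball] using Gd by blast
    then have kh: "k holomorphic_on ?D"
      unfolding k_def by (intro holomorphic_intros)
    have "(\<lambda>s. ell2_nth (H s) i) holomorphic_on ?D" for i
    proof -
      have "((\<lambda>s. ell2_nth (H s) i) has_field_derivative ell2_nth (H' s) i) (at s)" if "s \<in> ?D" for s
      proof -
        have "(*) (ell2_nth (H' s) i) = (\<lambda>d. ell2_nth (ell2_scale d (H' s)) i)"
          by (auto simp: ell2_nth_simps mult.commute)
        then show ?thesis
          unfolding has_field_derivative_def
          using bounded_linear.has_derivative[OF bounded_linear_ell2_nth H[OF that], of i] by simp
      qed
      then show ?thesis unfolding holomorphic_on_open[OF open_ball] by blast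
    qed
    then show "q j holomorphic_on ?D" for j
      unfolding q_def using kh by (cases j) (auto intro!: holomorphic_intros)
    fix s assume s: "s \<in> ?D"
    have "(\<lambda>i. (cmod (ell2_nth (H s) i))\<^sup>2) sums (norm (H s))\<^sup>2"
      unfolding norm_ell2_power2 by (rule summable_sums[OF ell2_summable])
    then have "(\<lambda>i. (cmod (q (Suc i) s))\<^sup>2) sums ((cmod (k s))\<^sup>2 * (norm (H s))\<^sup>2)"
      by (simp add: q_def norm_mult power_mult_distrib sums_mult)
    then have "(\<lambda>j. (cmod (q j s))\<^sup>2) sums ((cmod (k s))\<^sup>2 * (norm (H s))\<^sup>2 + (cmod (q 0 s))\<^sup>2)"
      by (rule sums_Suc)
    then show "(\<lambda>j. (cmod (q j s))\<^sup>2) sums exp (v s)"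
      using k2[OF s] by (simp add: q_def n_def algebra_simps)
  qed
qed

section \<open>The radial profile and its fourth derivative\<close>

text \<open>
  Up to the positive factor \<open>c\<close>, this polynomial is the fourth derivative at \<open>0\<close> of
  \<open>exp (c (f(1 + t) - f(1)))\<close>, where \<open>q = -f''(1)\<close>.  It increases with \<open>c\<close>, and
  at \<open>c = 1\<close> it is negative from \<open>q = 2/5\<close> on, the value for type III with \<open>n = 2\<close>.
\<close>

lemma quartic_coefficient_negative:
  fixes c q :: real
  assumes "0 < c" "c \<le> 1" "2 / 5 \<le> q" "q \<le> 1 / 2"
  shows "c ^ 3 - 6 * q * c\<^sup>2 + c * (15 * q\<^sup>2 - 4 * q + 2) - 1 - 3 / 2 * q + 7 * q\<^sup>2 - 15 * q ^ 3 < 0"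
proof -
  define P where "P c = c ^ 3 - 6 * q * c\<^sup>2 + c * (15 * q\<^sup>2 - 4 * q + 2) - 1 - 3 / 2 * q + 7 * q\<^sup>2 - 15 * q ^ 3" for c :: real
  define e where "e = q - 2 / 5"
  (* The last factor is the quadratic polynomial in c after completing squares in c and in q. *)
  have "P 1 - P c = (1 - c) * ((c + (1 - 6 * q) / 2)\<^sup>2 + 6 * (q - 7 / 12)\<^sup>2 + 17 / 24)"
    by (simp add: P_def power2_eq_square power3_eq_cube field_simps)
  moreover have "\<dots> \<ge> 0" using assms by (intro mult_nonneg_nonneg add_nonneg_nonneg) auto
  ultimately have "P c \<le> P 1" by simp
  moreover have "P 1 = - 1 / 25 - 11 / 10 * e + 4 * (e * e) - 15 * (e * e * e)"
    by (simp add: P_def e_def power2_eq_square power3_eq_cube field_simps)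
  moreover have "0 \<le> e" "e \<le> 1 / 10"
    using assms by (auto simp: e_def)
  moreover from this have "e * e \<le> e * (1 / 10)" "e * e * e \<ge> 0"
    by (intro mult_left_mono mult_nonneg_nonneg; simp)+
  ultimately have "P c < 0" by linarith
  then show ?thesis by (simp add: P_def)
qed

text \<open>
  The derivative of the potential as a function of \<open>\<N>\<close>, for both types.
\<close>

definition stenzel_slope :: "real \<Rightarrow> real \<Rightarrow> real \<Rightarrow> real \<Rightarrow> real" where
  "stenzel_slope A B b x = x powr (- 1 / 2) * (A + B * x) powr b"

text \<open>
  For \<open>y = x\<^sup>k g\<^bsup>2k\<^esup>\<close> the equation becomes \<open>(x - 1) y' + k y = k (A + B x) + (x - 1) B\<close>, which
  \<open>A + B x\<close> solves.  The integrating factor \<open>(x - 1)\<^bsup>k - 1\<^esup>\<close> makes \<open>(x - 1)\<^sup>k (y - A - B x)\<close>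
  constant, and it vanishes at \<open>1\<close>: the singular point forces uniqueness.
\<close>

lemma stenzel_ode_solution:
  fixes g g' :: "real \<Rightarrow> real" and k :: nat
  assumes k: "k > 0" and AB: "A > 0" "B \<ge> 0" "A + B = 1"
    and g1: "g 1 = 1" and der: "\<And>x. x \<ge> 1 \<Longrightarrow> (g has_real_derivative g' x) (at x within {1..})"
    and ode: "\<And>x. x \<ge> 1 \<Longrightarrow> (2 * x - 1) * x ^ (k - 1) * g x ^ (2 * k)
        + 2 * (x - 1) * x ^ k * g x ^ (2 * k - 1) * g' x = A + B * x + (x - 1) * B / k"
    and x: "x \<ge> 1"
  shows "g x = stenzel_slope A B (1 / (2 * k)) x"
proof -
  (* The derivative of Z is k (x - 1)^(k - 1) times the difference of the two sides of the equation. *)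
  define Z where "Z x = (x - 1) ^ k * (x ^ k * g x ^ (2 * k) - A - B * x)" for x
  obtain m where m: "k = Suc m" using k gr0_implies_Suc by blast
  have "(Z has_real_derivative 0) (at x within {1..})" if x: "x \<in> {1..}" for x
  proof -
    have "(Z has_real_derivative
        k * (x - 1) ^ (k - 1) * (x ^ k * g x ^ (2 * k) - A - B * x)
        + (x - 1) ^ k * (k * x ^ (k - 1) * g x ^ (2 * k) + x ^ k * (2 * k * g x ^ (2 * k - 1) * g' x) - B))
        (at x within {1..})"
      unfolding Z_def using x by (auto intro!: derivative_eq_intros der simp: mult_ac)
    also have "k * (x - 1) ^ (k - 1) * (x ^ k * g x ^ (2 * k) - A - B * x)
        + (x - 1) ^ k * (k * x ^ (k - 1) * g x ^ (2 * k) + x ^ k * (2 * k * g x ^ (2 * k - 1) * g' x) - B)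
      = k * (x - 1) ^ (k - 1) * ((2 * x - 1) * x ^ (k - 1) * g x ^ (2 * k)
        + 2 * (x - 1) * x ^ k * g x ^ (2 * k - 1) * g' x - (A + B * x + (x - 1) * B / k))"
      by (simp add: m field_simps)
    also have "\<dots> = 0" using ode[of x] x by simp
    finally show ?thesis .
  qed
  then obtain C where "\<forall>x\<in>{1..}. Z x = C"
    using has_field_derivative_zero_constant[of "{1..}" Z] convex_real_interval(1) by blast
  moreover have "Z 1 = 0" using k by (simp add: Z_def)
  ultimately have Z0: "Z x = 0" if "x \<ge> 1" for x using that by (metis atLeast_iff order_refl)
  have y: "x ^ k * g x ^ (2 * k) = A + B * x" if "x \<ge> 1" for x
    using Z0[OF that] AB g1 that by (cases "x = 1") (auto simp: Z_def)
  have pos: "A + B * x > 0" if "x \<ge> 1" for x using AB that by (simp add: add_pos_nonneg)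
  have nz: "g x \<noteq> 0" if "x \<ge> 1" for x using y[OF that] pos[OF that] k by (auto simp: zero_power)
  have cont: "continuous_on {1..x} g" for x
    using der by (meson DERIV_continuous atLeastAtMost_iff atLeast_iff continuous_on_eq_continuous_within
        continuous_within_subset subsetI)
  have gpos: "g x > 0"
  proof (rule ccontr)
    assume "\<not> g x > 0"
    then have "\<exists>y\<ge>1. y \<le> x \<and> g y = 0"
      using IVT2'[of g x 0 1] g1 x cont by auto
    then show False using nz by auto
  qed
  define s where "s = stenzel_slope A B (1 / (2 * k)) x"
  have spos: "s > 0" using x pos[OF x] by (simp add: s_def stenzel_slope_def)
  have "(x powr (- 1 / 2)) ^ (2 * k) = ((x powr (- 1 / 2)) ^ 2) ^ k" by (simp add: power_mult)
  also have "(x powr (- 1 / 2)) ^ 2 = 1 / x" using x by (simp add: power2_eq_square flip: powr_add)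
  finally have "s ^ (2 * k) = (A + B * x) / x ^ k"
    using pos[OF x] k x
    by (simp add: s_def stenzel_slope_def power_mult_distrib powr_power power_divide)
  also have "\<dots> = g x ^ (2 * k)" using y[OF x] x by (simp add: field_simps)
  finally have "g x = s"
    using spos gpos k by (metis less_imp_le mult_pos_pos pos2 power_eq_imp_eq_base)
  then show ?thesis by (simp add: s_def)
qed

lemma smooth_on_ray_derivative:
  assumes "smooth_on_ray f" "x \<ge> 1"
  shows "((ray_deriv ^^ i) f has_real_derivative (ray_deriv ^^ Suc i) f x) (at x within {1..})"
proof -
  obtain D where D: "((ray_deriv ^^ i) f has_real_derivative D) (at x within {1..})"
    using assms unfolding smooth_on_ray_def real_differentiable_def by blast
  then show ?thesis using ray_deriv_eq[OF D assms(2)] by simp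
qed

lemma profile_II_slope:
  assumes f: "profile_II n f" and n: "n > 0" and x: "x \<ge> 1"
  shows "(f has_real_derivative stenzel_slope 1 0 (1 / (2 * n)) x) (at x within {1..})"
proof -
  have "smooth_on_ray f" using f by (simp add: profile_II_def)
  note der = smooth_on_ray_derivative[OF this]
  have "ray_deriv f x = stenzel_slope 1 0 (1 / (2 * n)) x"
    by (rule stenzel_ode_solution[OF n, where g' = "ray_deriv (ray_deriv f)"])
      (use f x der[of _ 1, simplified] in \<open>auto simp: profile_II_def\<close>)
  then show ?thesis using der[of x 0] x by simp
qed

lemma profile_III_slope:
  assumes f: "profile_III n f" and n: "n > 0" and x: "x \<ge> 1"
  shows "(f has_real_derivative stenzel_slope (1 / (2 * n + 1)) (2 * n / (2 * n + 1)) (1 / (2 * (2 * n))) x)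
           (at x within {1..})"
proof -
  have "smooth_on_ray f" using f by (simp add: profile_III_def)
  note der = smooth_on_ray_derivative[OF this]
  have affine: "x = 1 / (K + 1) + K / (K + 1) * x + (x - 1) * (K / (K + 1)) / K" if "K > 0" for K x :: real
    using that by (simp add: divide_simps) (simp add: algebra_simps)
  have AB: "1 / (1 + 2 * real n) + 2 * real n / (1 + 2 * real n) = 1"
    by (simp flip: add_divide_distrib)
  have "ray_deriv f x = stenzel_slope (1 / (2 * n + 1)) (2 * n / (2 * n + 1)) (1 / (2 * (2 * n))) x"
  proof -
    have "ray_deriv f x = stenzel_slope (1 / (2 * n + 1)) (2 * n / (2 * n + 1)) (1 / (2 * (2 * n :: nat))) x"
    proof (rule stenzel_ode_solution[where g' = "ray_deriv (ray_deriv f)"])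
      fix x :: real assume x: "x \<ge> 1"
      obtain m where m: "n = Suc m" using n gr0_implies_Suc by blast
      have e: "x ^ (2 * n - 1) = x * x ^ (2 * n - 2)" "x ^ (2 * n) = x * (x * x ^ (2 * n - 2))"
          "2 * (2 * n) = 4 * n"
        by (simp_all add: m)
      have "(2 * x - 1) * x ^ (2 * n - 1) * ray_deriv f x ^ (2 * (2 * n))
        + 2 * (x - 1) * x ^ (2 * n) * ray_deriv f x ^ (2 * (2 * n) - 1) * ray_deriv (ray_deriv f) x
        = x * ((2 * x - 1) * x ^ (2 * n - 2) * ray_deriv f x ^ (4 * n)
        + 2 * (x - 1) * x ^ (2 * n - 1) * ray_deriv f x ^ (4 * n - 1) * ray_deriv (ray_deriv f) x)"
        unfolding e by (simp add: algebra_simps)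
      also have "\<dots> = x" using f x by (simp add: profile_III_def)
      also have "x = 1 / (2 * n + 1) + 2 * n / (2 * n + 1) * x + (x - 1) * (2 * n / (2 * n + 1)) / (2 * n :: nat)"
        using affine[of "2 * real n" x] n by (simp add: add.commute)
      finally show "(2 * x - 1) * x ^ (2 * n - 1) * ray_deriv f x ^ (2 * (2 * n))
        + 2 * (x - 1) * x ^ (2 * n) * ray_deriv f x ^ (2 * (2 * n) - 1) * ray_deriv (ray_deriv f) x
        = 1 / (2 * n + 1) + 2 * n / (2 * n + 1) * x + (x - 1) * (2 * n / (2 * n + 1)) / (2 * n :: nat)" .
    qed (use f n x AB der[of _ 1, simplified] in \<open>auto simp: profile_III_def add.commute\<close>)
    then show ?thesis by simp
  qed
  then show ?thesis using der[of x 0] x by (simp add: add.commute)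
qed

lemma stenzel_slope_has_derivative:
  assumes x: "x > 0" and y: "A + B * x > 0"
  shows "(stenzel_slope A B b has_real_derivative
      stenzel_slope A B b x * (b * B * inverse (A + B * x) - inverse x / 2)) (at x)"
proof -
  have "(stenzel_slope A B b has_real_derivative
      (- 1 / 2) * x powr (- 1 / 2 - 1) * (A + B * x) powr b
        + x powr (- 1 / 2) * (b * B * (A + B * x) powr (b - 1))) (at x)"
    unfolding stenzel_slope_def[abs_def] using assms
    by (auto intro!: derivative_eq_intros simp: algebra_simps)
  moreover have "(- 1 / 2) * (u / x) * v + u * (b * B * (v / y)) = u * v * (b * B * inverse y - inverse x / 2)"
    if "y \<noteq> 0" for u v y :: real
    using that x by (simp add: field_simps)
  ultimately show ?thesis
    using y unfolding powr_minus_one_real[OF x] powr_minus_one_real[OF y] stenzel_slope_def by simp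
qed

text \<open>
  The two types satisfy \<open>b B = 0\<close> and \<open>b B = 1/(2 (k + 1)), B = k/(k + 1)\<close>.  The third condition
  on \<open>b B\<close> holds in both cases and makes the derivatives of the slope at \<open>1\<close> polynomials in
  \<open>b B\<close> alone; the bound \<open>1/10\<close> is attained for type III with \<open>n = 2\<close>.
\<close>

lemma exp_stenzel_not_absolutely_monotone:
  fixes f :: "real \<Rightarrow> real" and d :: "nat \<Rightarrow> real"
  assumes AB: "A > 0" "B \<ge> 0" "A + B = 1" and b: "0 \<le> b * B" "b * B \<le> 1 / 10" "b * B * B = b * B * (1 - 2 * (b * B))"
    and c: "0 < c" "c \<le> 1" and \<rho>: "\<rho> > 0"
    and f: "\<And>x. x \<ge> 1 \<Longrightarrow> (f has_real_derivative stenzel_slope A B b x) (at x within {1..})"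
    and d: "\<And>m. d m \<ge> 0" "\<And>t. t \<in> {0<..<\<rho>} \<Longrightarrow> (\<lambda>m. d m * t ^ m) sums exp (c * f (1 + t))"
  shows False
proof -
  define g where "g = stenzel_slope A B b"
  define l1 where "l1 x = b * B * inverse (A + B * x) - inverse x / 2" for x
  define l2 where "l2 x = (inverse x)\<^sup>2 / 2 - b * B * B * (inverse (A + B * x))\<^sup>2" for x
  define l3 where "l3 x = 2 * (b * B * B * B) * inverse (A + B * x) ^ 3 - inverse x ^ 3" for x
  have pos: "A + B * x > 0" if "x \<ge> 1" for x using AB that by (simp add: add_pos_nonneg)
  have Dg: "(g has_real_derivative g x * l1 x) (at x)" if "x \<ge> 1" for x
    unfolding g_def l1_def by (rule stenzel_slope_has_derivative) (use pos that in auto)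
  have D1: "(l1 has_real_derivative l2 x) (at x)" if "x \<ge> 1" for x
    unfolding l1_def l2_def using pos[OF that] that
    by (auto intro!: derivative_eq_intros simp: power2_eq_square algebra_simps)
  have D2: "(l2 has_real_derivative l3 x) (at x)" if "x \<ge> 1" for x
    unfolding l2_def l3_def using pos[OF that] that
    by (auto intro!: derivative_eq_intros simp: power2_eq_square power3_eq_cube algebra_simps)
  have D3: "isCont l3 x" if "x \<ge> 1" for x
    unfolding l3_def using pos[OF that] that by (intro continuous_intros) auto
  (* The derivatives of E(t) = exp (c f(1 + t)) are E(t) T1(1 + t), ..., E(t) T4(1 + t), where the
     slope g has logarithmic derivative l1, with derivatives l2 and l3. *)
  define T1 where "T1 x = c * g x" for x
  define T2 where "T2 x = c\<^sup>2 * (g x)\<^sup>2 + c * g x * l1 x" for x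
  define T3 where "T3 x = c ^ 3 * g x ^ 3 + 3 * c\<^sup>2 * (g x)\<^sup>2 * l1 x + c * g x * ((l1 x)\<^sup>2 + l2 x)" for x
  define T4 where "T4 x = c ^ 4 * g x ^ 4 + 6 * c ^ 3 * g x ^ 3 * l1 x
     + c\<^sup>2 * (g x)\<^sup>2 * (7 * (l1 x)\<^sup>2 + 4 * l2 x) + c * g x * (l1 x ^ 3 + 3 * l1 x * l2 x + l3 x)" for x
  define E where "E t = exp (c * f (1 + t))" for t
  have Df: "(f has_real_derivative g x) (at x)" if "x > 1" for x
  proof -
    have "at x within {1..} = at x" using that by (intro at_within_interior) auto
    then show ?thesis using f[of x] that by (simp add: g_def)
  qed
  have DT1: "(T1 has_real_derivative T2 x - T1 x * c * g x) (at x)" if "x \<ge> 1" for x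
    unfolding T1_def T2_def using that
    by (auto intro!: derivative_eq_intros Dg simp: power2_eq_square algebra_simps)
  have DT2: "(T2 has_real_derivative T3 x - T2 x * c * g x) (at x)" if "x \<ge> 1" for x
    unfolding T2_def T3_def using that
    by (auto intro!: derivative_eq_intros Dg D1 simp: power2_eq_square power3_eq_cube algebra_simps)
  have DT3: "(T3 has_real_derivative T4 x - T3 x * c * g x) (at x)" if "x \<ge> 1" for x
    unfolding T3_def T4_def using that
    by (auto intro!: derivative_eq_intros Dg D1 D2 simp: eval_nat_numeral algebra_simps)
  have DE: "(E has_real_derivative E t * T1 (1 + t)) (at t)" if "t > 0" for t
    unfolding E_def T1_def
    by (rule derivative_eq_intros DERIV_chain2[OF Df] refl | use that in simp)+
  have step: "((\<lambda>t. E t * T (1 + t)) has_real_derivative E t * T' (1 + t)) (at t)"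
    if "t > 0" "\<And>x. x \<ge> 1 \<Longrightarrow> (T has_real_derivative T' x - T x * c * g x) (at x)" for t T T'
    using that(1) by (auto intro!: derivative_eq_intros DE DERIV_chain2[OF that(2)] simp: T1_def algebra_simps)
  have DE0: "((\<lambda>t. exp (c * f (1 + t))) has_real_derivative E t * T1 (1 + t)) (at t)" if "t \<in> {0<..<\<rho>}" for t
    using DE[of t] that by (simp add: E_def[abs_def])
  have DE1: "((\<lambda>t. E t * T1 (1 + t)) has_real_derivative E t * T2 (1 + t)) (at t)" if "t \<in> {0<..<\<rho>}" for t
    using step[of t T1 T2] DT1 that by simp
  have DE2: "((\<lambda>t. E t * T2 (1 + t)) has_real_derivative E t * T3 (1 + t)) (at t)" if "t \<in> {0<..<\<rho>}" for t
    using step[of t T2 T3] DT2 that by simp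
  have DE3: "((\<lambda>t. E t * T3 (1 + t)) has_real_derivative E t * T4 (1 + t)) (at t)" if "t \<in> {0<..<\<rho>}" for t
    using step[of t T3 T4] DT3 that by simp
  obtain d1 where d1: "\<And>m. d1 m \<ge> 0" "\<And>t. t \<in> {0<..<\<rho>} \<Longrightarrow> (\<lambda>m. d1 m * t ^ m) sums (E t * T1 (1 + t))"
    by (rule nonneg_power_series_derivative[where \<rho> = \<rho>, OF d DE0])
      (assumption | rule that)+
  obtain d2 where d2: "\<And>m. d2 m \<ge> 0" "\<And>t. t \<in> {0<..<\<rho>} \<Longrightarrow> (\<lambda>m. d2 m * t ^ m) sums (E t * T2 (1 + t))"
    by (rule nonneg_power_series_derivative[where \<rho> = \<rho>, OF d1 DE1])
      (assumption | rule that)+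
  obtain d3 where d3: "\<And>m. d3 m \<ge> 0" "\<And>t. t \<in> {0<..<\<rho>} \<Longrightarrow> (\<lambda>m. d3 m * t ^ m) sums (E t * T3 (1 + t))"
    by (rule nonneg_power_series_derivative[where \<rho> = \<rho>, OF d2 DE2])
      (assumption | rule that)+
  obtain d4 where d4: "\<And>m. d4 m \<ge> 0" "\<And>t. t \<in> {0<..<\<rho>} \<Longrightarrow> (\<lambda>m. d4 m * t ^ m) sums (E t * T4 (1 + t))"
    by (rule nonneg_power_series_derivative[where \<rho> = \<rho>, OF d3 DE3])
      (assumption | rule that)+
  have nn: "T4 (1 + t) \<ge> 0" if t: "t \<in> {0<..<\<rho>}" for t
  proof -
    have "0 \<le> E t * T4 (1 + t)"
      by (rule sums_le[OF _ sums_zero d4(2)[OF t]]) (use t d4(1) in auto)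
    moreover have "E t > 0" by (simp add: E_def)
    ultimately show ?thesis by (simp add: zero_le_mult_iff)
  qed
  (* Nonnegativity on (0, \<rho>) passes to the end point t = 0, where T4 is computed. *)
  have "isCont T4 1"
    unfolding T4_def
    by (intro continuous_intros DERIV_isCont[OF Dg] DERIV_isCont[OF D1] DERIV_isCont[OF D2] D3) auto
  then have "((\<lambda>t. T4 (1 + t)) \<longlongrightarrow> T4 1) (at_right 0)"
    unfolding isCont_iff by (rule tendsto_within_subset) auto
  moreover have "eventually (\<lambda>t. T4 (1 + t) \<ge> 0) (at_right 0)"
    using eventually_at_right_real[OF \<rho>] by eventually_elim (rule nn)
  ultimately have "T4 1 \<ge> 0"
    by (rule tendsto_lowerbound) auto
  moreover have "T4 1 < 0"
  proof -
    define q where "q = 1 / 2 - b * B"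
    define p where "p = b * B"
    have b3: "p * B = p * (1 - 2 * p)" using b by (simp add: p_def)
    have B3: "b * B * B * B = p * (1 - 2 * p) * (1 - 2 * p)"
      using b3 by (metis mult.assoc mult.commute p_def)
    have pq: "p = 1 / 2 - q" by (simp add: p_def q_def)
    have v: "g 1 = 1" "l1 1 = - q" "l2 1 = 1 / 2 - 2 * p * q" "l3 1 = 8 * p * q\<^sup>2 - 1"
      using AB b B3 by (simp_all add: g_def stenzel_slope_def l1_def l2_def l3_def q_def p_def power2_eq_square algebra_simps)
    have "T4 1 = c * (c ^ 3 - 6 * q * c\<^sup>2 + c * (15 * q\<^sup>2 - 4 * q + 2) - 1 - 3 / 2 * q + 7 * q\<^sup>2 - 15 * q ^ 3)"
      unfolding T4_def v pq by (simp add: eval_nat_numeral field_simps)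
    moreover have "\<dots> < 0"
      using c b quartic_coefficient_negative[of c q] by (intro mult_pos_neg) (auto simp: q_def)
    ultimately show ?thesis by simp
  qed
  ultimately show False by simp
qed

section \<open>The two discs\<close>

lemma axis_vector_scale: "axis i s = s *s (axis i 1 :: complex ^ 'n::finite)"
  by (simp add: axis_def vec_eq_iff)

lemma norm_axis_complex: "norm (axis i s :: complex ^ 'n::finite) = cmod s"
proof -
  have "(\<Sum>j\<in>UNIV. (norm ((axis i s :: complex ^ 'n) $ j))\<^sup>2) = (cmod s)\<^sup>2"
    by (simp add: axis_def if_distrib if_distribR sum.delta' cong: if_cong)
  then show ?thesis by (simp add: norm_vec_def L2_set_def)
qed

text \<open>
  Only one diagonal entry of the metric is compared, along the coordinate axis \<open>i\<close> of a single
  chart.  The factor \<open>c\<close> covers the rescaled metrics.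
\<close>

lemma projectively_induced_slice_sum_of_squares:
  fixes \<A> :: "('p, 'm::finite) chart set" and i :: 'm and f g g' :: "real \<Rightarrow> real"
  assumes ind: "projectively_induced M \<A> h" and C: "C \<in> \<A>"
    and metric: "\<And>x. x \<in> fst C \<Longrightarrow> h C x $ i $ i = of_real c * kahler_metric \<phi> C x $ i $ i"
    and dom: "\<And>s. axis i s \<in> fst C"
    and slice: "\<And>s. \<phi> (snd C (axis i s)) = f (1 + (cmod s)\<^sup>2)"
    and f: "\<And>y. y \<ge> 1 \<Longrightarrow> (f has_real_derivative g y) (at y within {1..})"
    and g: "\<And>y. y \<ge> 1 \<Longrightarrow> (g has_real_derivative g' y) (at y)"
    and g': "continuous_on {1..} g'"
  obtains R and q :: "nat \<Rightarrow> complex \<Rightarrow> complex" where "R > 0" "\<And>j. q j holomorphic_on ball 0 R"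
    "\<And>s. s \<in> ball 0 R \<Longrightarrow> (\<lambda>j. (cmod (q j s))\<^sup>2) sums exp (c * f (1 + (cmod s)\<^sup>2))"
proof -
  obtain U \<psi> where CU: "C = (U, \<psi>)" by (cases C)
  obtain N F where hol: "holomorphic_to_CP N M \<A> F"
    and pb: "\<And>x a. x \<in> U \<Longrightarrow> F (\<psi> x) \<in> affine_domain a \<Longrightarrow> pullback_fubini_study F a C x = h C x"
    using ind C unfolding projectively_induced_def CU by fastforce
  have loc: "\<forall>x\<in>U. \<exists>a V. open V \<and> x \<in> V \<and> V \<subseteq> U \<and> (\<forall>y\<in>V. F (\<psi> y) \<in> affine_domain a)
      \<and> holomorphic_ell2 (\<lambda>y. affine_coords a (F (\<psi> y))) V"
    using bspec[OF conjunct2[OF hol[unfolded holomorphic_to_CP_def]] C] by (simp add: CU)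
  have "(0 :: complex ^ 'm) \<in> U"
  proof -
    have "axis i (0 :: complex) = 0" by (simp add: axis_def vec_eq_iff)
    then show ?thesis using dom[of 0] unfolding CU by (metis fst_conv)
  qed
  from bspec[OF loc this] obtain a V where aV: "open V \<and> 0 \<in> V \<and> V \<subseteq> U
      \<and> (\<forall>y\<in>V. F (\<psi> y) \<in> affine_domain a) \<and> holomorphic_ell2 (\<lambda>y. affine_coords a (F (\<psi> y))) V"
    by (elim exE) (rule that)
  then have V: "open V" "0 \<in> V" "V \<subseteq> U" "\<And>y. y \<in> V \<Longrightarrow> F (\<psi> y) \<in> affine_domain a"
    and hV: "holomorphic_ell2 (\<lambda>y. affine_coords a (F (\<psi> y))) V"
    by simp_all
  obtain R where R: "R > 0" "ball 0 R \<subseteq> V" using V(1,2) open_contains_ball by blast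
  define e :: "complex ^ 'm" where "e = axis i 1"
  have axis: "axis i s = s *s e" for s unfolding e_def by (rule axis_vector_scale)
  have inV: "axis i s \<in> V" if "s \<in> ball 0 R" for s
    using that R(2) by (auto simp: norm_axis_complex)
  define k where "k = (\<lambda>y. affine_coords a (F (\<psi> y)))"
  define H where "H s = k (axis i s)" for s
  define H' where "H' s = frechet_derivative k (at (axis i s)) e" for s
  define L where "L s = c * (g (1 + (cmod s)\<^sup>2) + (cmod s)\<^sup>2 * g' (1 + (cmod s)\<^sup>2))" for s
  have Hd: "(H has_derivative (\<lambda>d. ell2_scale d (H' s))) (at s)" if s: "s \<in> ball 0 R" for s
  proof -
    obtain D where D: "(k has_derivative D) (at (axis i s))" "\<And>c u. D (c *s u) = ell2_scale c (D u)"
      using hV inV[OF s] unfolding holomorphic_ell2_def k_def by blast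
    have bl: "bounded_linear (\<lambda>s. axis i s :: complex ^ 'm)"
    proof (rule bounded_linear_intro[where K = 1])
      show "norm (axis i s :: complex ^ 'm) \<le> norm s * 1" for s by (simp add: norm_axis_complex)
    qed (auto simp: axis_def vec_eq_iff)
    have "(H has_derivative (\<lambda>d. D (axis i d))) (at s)"
      unfolding H_def
      using has_derivative_compose[OF bounded_linear.has_derivative[OF bl has_derivative_ident] D(1)] by simp
    moreover have "H' s = D e" unfolding H'_def using frechet_derivative_at[OF D(1)] by simp
    ultimately show ?thesis by (simp add: axis D(2))
  qed
  have met: "fubini_study (H s) (H' s) (H' s) = of_real (L s)" if s: "s \<in> ball 0 R" for s
  proof -
    have xU: "axis i s \<in> U" using inV[OF s] V(3) by blast
    have "fubini_study (H s) (H' s) (H' s) = pullback_fubini_study F a C (axis i s) $ i $ i"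
      by (simp add: pullback_fubini_study_def Let_def CU H_def H'_def k_def e_def)
    also have "\<dots> = h C (axis i s) $ i $ i" using pb[OF xU V(4)[OF inV[OF s]]] by simp
    also have "\<dots> = of_real c * complex_hessian (*s) (\<lambda>y. \<phi> (\<psi> y)) (axis i s) e e"
      using metric[of "axis i s"] xU by (simp add: CU kahler_metric_def e_def)
    also have "complex_hessian (*s) (\<lambda>y. \<phi> (\<psi> y)) (axis i s) e e
        = of_real (g (1 + (cmod s)\<^sup>2) + (cmod s)\<^sup>2 * g' (1 + (cmod s)\<^sup>2))"
    proof (rule radial_hessian[OF _ f g open_UNIV])
      show "\<phi> (\<psi> (axis i s + \<tau> *s e)) = f (1 + (cmod (s + \<tau>))\<^sup>2)" for \<tau>
        using slice[of "s + \<tau>"] by (simp add: CU axis vec.scale_left_distrib)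
    qed (auto simp: vec.scale_left_distrib add.assoc)
    finally show ?thesis by (simp add: L_def)
  qed
  have comp: "continuous_on (ball 0 R) (\<lambda>s::complex. u (1 + (cmod s)\<^sup>2))"
    if "continuous_on {1..} u" for u :: "real \<Rightarrow> real"
    by (rule continuous_on_compose2[OF that]) (auto intro!: continuous_intros)
  have "continuous_on {1..} g"
    using g by (meson DERIV_isCont atLeast_iff continuous_at_imp_continuous_on)
  then have Lc: "continuous_on (ball 0 R) L"
    unfolding L_def by (intro continuous_intros comp g')
  have cf: "((\<lambda>y. c * f y) has_real_derivative c * g y) (at y within {1..})" if "y \<ge> 1" for y
    using f[OF that] by (rule DERIV_cmult)
  have cg: "((\<lambda>y. c * g y) has_real_derivative c * g' y) (at y)" if "y \<ge> 1" for y
    using g[OF that] by (rule DERIV_cmult)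
  define P where "P s = of_real (c * g (1 + (cmod s)\<^sup>2)) * cnj s" for s
  define Q where "Q s = of_real (c * g' (1 + (cmod s)\<^sup>2)) * (cnj s)\<^sup>2" for s
  have v: "((\<lambda>s. c * f (1 + (cmod s)\<^sup>2)) has_derivative (\<lambda>d. 2 * Re (P s * d))) (at s)" for s
    unfolding P_def
    by (rule radial_potential_has_derivative[where f = "\<lambda>y. c * f y" and g = "\<lambda>y. c * g y", OF cf])
  have Leq: "L s = c * g (1 + (cmod s)\<^sup>2) + (cmod s)\<^sup>2 * (c * g' (1 + (cmod s)\<^sup>2))" for s
    by (simp add: L_def algebra_simps)
  have Pd: "(P has_derivative (\<lambda>d. Q s * d + of_real (L s) * cnj d)) (at s)" for s
    unfolding P_def[abs_def] Q_def Leq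
    by (rule radial_gradient_has_derivative[where g = "\<lambda>y. c * g y" and g' = "\<lambda>y. c * g' y", OF cg])
  show ?thesis
    by (rule potential_sum_of_squares[OF Hd met v Pd Lc]) (assumption | rule that R(1))+
qed

lemma stenzel_slice_not_projectively_induced:
  fixes \<A> :: "('p, 'm::finite) chart set" and i :: 'm and f :: "real \<Rightarrow> real"
  assumes AB: "A > 0" "B \<ge> 0" "A + B = 1"
    and b: "0 \<le> b * B" "b * B \<le> 1 / 10" "b * B * B = b * B * (1 - 2 * (b * B))"
    and c: "0 < c" "c \<le> 1"
    and f: "\<And>x. x \<ge> 1 \<Longrightarrow> (f has_real_derivative stenzel_slope A B b x) (at x within {1..})"
    and C: "C \<in> \<A>"
    and metric: "\<And>x. h C x $ i $ i = of_real c * kahler_metric \<phi> C x $ i $ i"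
    and dom: "\<And>s. axis i s \<in> fst C"
    and slice: "\<And>s. \<phi> (snd C (axis i s)) = f (1 + (cmod s)\<^sup>2)"
  shows "\<not> projectively_induced M \<A> h"
proof
  assume ind: "projectively_induced M \<A> h"
  let ?g' = "\<lambda>x. stenzel_slope A B b x * (b * B * inverse (A + B * x) - inverse x / 2)"
  have pos: "A + B * x > 0" if "x \<ge> 1" for x using AB that by (simp add: add_pos_nonneg)
  have g: "(stenzel_slope A B b has_real_derivative ?g' x) (at x)" if "x \<ge> 1" for x
    by (rule stenzel_slope_has_derivative) (use pos that in auto)
  have "continuous_on {1..} (stenzel_slope A B b)"
    using g by (meson DERIV_isCont atLeast_iff continuous_at_imp_continuous_on)
  then have g': "continuous_on {1..} ?g'"
    by (intro continuous_intros) (use pos in \<open>auto simp: less_imp_neq[symmetric]\<close>)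
  obtain R q where R: "R > 0" and q: "\<And>j. q j holomorphic_on ball 0 R"
    "\<And>s. s \<in> ball 0 R \<Longrightarrow> (\<lambda>j. (cmod (q j s))\<^sup>2) sums exp (c * f (1 + (cmod s)\<^sup>2))"
    by (rule projectively_induced_slice_sum_of_squares[OF ind C metric dom slice f g g'])
      (assumption | rule that)+
  obtain d where "\<And>m. d m \<ge> (0::real)"
      "\<And>t. t \<in> {0<..<R\<^sup>2} \<Longrightarrow> (\<lambda>m. d m * t ^ m) sums exp (c * f (1 + t))"
    by (rule radial_sum_of_squares_power_series[OF R, of q "\<lambda>t. exp (c * f (1 + t))"]) (use q in auto)
  then show False
    using exp_stenzel_not_absolutely_monotone[OF AB b c _ f, of "R\<^sup>2" d] R by simp
qed

lemma sum_UNIV_option: "(\<Sum>j\<in>UNIV. h j) = h None + (\<Sum>j\<in>UNIV. h (Some j))"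
  for h :: "'a::finite option \<Rightarrow> 'b::comm_monoid_add"
  by (simp add: UNIV_option_conv sum.reindex)

lemma sum_UNIV_option_bool:
  "(\<Sum>j\<in>UNIV. h j) = h (None, True) + h (None, False) + (\<Sum>j\<in>UNIV. h (Some j, True) + h (Some j, False))"
  for h :: "'a::finite option \<times> bool \<Rightarrow> 'b::comm_monoid_add"
proof -
  have "(\<Sum>j\<in>UNIV. h j) = (\<Sum>a\<in>UNIV. \<Sum>b\<in>UNIV. h (a, b))"
    by (simp add: sum.cartesian_product UNIV_Times_UNIV)
  then show ?thesis by (simp add: sum_UNIV_option UNIV_bool ac_simps)
qed

lemma slice_II:
  fixes j0 :: "'m::finite" and s :: complex
  shows "param_II id id (axis (Inl j0) s) \<in> (M_II :: 'm point_II set)"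
    and "N_II (param_II id id (axis (Inl j0) s) :: 'm point_II) = 1 + (cmod s)\<^sup>2"
proof -
  define z :: "complex ^ 'm option" where "z = affine_vec id (\<lambda>j. axis (Inl j0) s $ (Inl j :: 'm + 'm))"
  define w :: "complex ^ 'm option" where "w = affine_vec id (\<lambda>j. axis (Inl j0) s $ (Inr j :: 'm + 'm))"
  have z: "z $ None = 1" "z $ Some j = (if j = j0 then s else 0)" for j
    by (simp_all add: z_def affine_vec_def axis_def)
  have w: "w $ None = 1" "w $ Some j = 0" for j
    by (simp_all add: w_def affine_vec_def axis_def)
  have nz: "z \<noteq> 0" "w \<noteq> 0" by (simp_all add: z_def w_def affine_vec_nz)
  have p: "param_II id id (axis (Inl j0) s) = (vec.span {z}, vec.span {w})"
    by (simp add: param_II_def z_def w_def)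
  have zw: "(\<Sum>j\<in>UNIV. z $ j * w $ j) = 1" by (simp add: sum_UNIV_option z w)
  show "param_II id id (axis (Inl j0) s) \<in> (M_II :: 'm point_II set)"
    unfolding p using nz zw by (simp add: mem_M_II)
  have "(\<Sum>j\<in>UNIV. (cmod (z $ j))\<^sup>2) = 1 + (cmod s)\<^sup>2" "(\<Sum>j\<in>UNIV. (cmod (w $ j))\<^sup>2) = 1"
    by (simp_all add: sum_UNIV_option z w if_distrib if_distribR sum.delta cong: if_cong)
  then show "N_II (param_II id id (axis (Inl j0) s) :: 'm point_II) = 1 + (cmod s)\<^sup>2"
    unfolding p using nz zw by (simp add: N_II_span norm_fun_II_def)
qed

lemma slice_III:
  fixes j0 :: "'m::finite" and s :: complex
  shows "param_III id (axis (Inl (j0, False)) s) \<in> (M_III :: 'm point_III set)"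
    and "N_III (param_III id (axis (Inl (j0, False)) s) :: 'm point_III) = 1 + (cmod s)\<^sup>2"
proof -
  define \<zeta> \<eta> where "\<zeta> j = axis (Inl (j0, False)) s $ (Inl j :: 'm \<times> bool + 'm \<times> bool)"
    and "\<eta> j = axis (Inl (j0, False)) s $ (Inr j :: 'm \<times> bool + 'm \<times> bool)" for j
  define z w where "z = frame_vec id False \<zeta>" and "w = frame_vec id True \<eta>"
  have z: "z $ (None, b) = (if b then 0 else 1)" "z $ (Some j, b) = (if j = j0 \<and> \<not> b then s else 0)" for j b
    by (auto simp: z_def \<zeta>_def frame_vec_def axis_def)
  have w: "w $ (None, b) = (if b then 1 else 0)" "w $ (Some j, b) = 0" for j b
    by (auto simp: w_def \<eta>_def frame_vec_def axis_def)
  have p: "param_III id (axis (Inl (j0, False)) s) = vec.span {z, w}"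
    by (simp add: param_III_def z_def w_def \<zeta>_def[abs_def] \<eta>_def[abs_def])
  have dim: "vec.dim (vec.span {z, w}) = 2"
    unfolding z_def w_def by (rule dim_frame) simp
  have sy: "sympl z w = - 1" by (simp add: sympl_def sum_UNIV_option z w)
  show "param_III id (axis (Inl (j0, False)) s) \<in> (M_III :: 'm point_III set)"
    unfolding p mem_M_III[OF dim] sy by simp
  have "(\<Sum>j\<in>UNIV. (cmod (z $ j))\<^sup>2) = 1 + (cmod s)\<^sup>2" "(\<Sum>j\<in>UNIV. (cmod (w $ j))\<^sup>2) = 1"
    "(\<Sum>j\<in>UNIV. z $ j * cnj (w $ j)) = 0"
    by (simp_all add: sum_UNIV_option_bool z w if_distrib if_distribR sum.delta cong: if_cong)
  then show "N_III (param_III id (axis (Inl (j0, False)) s) :: 'm point_III) = 1 + (cmod s)\<^sup>2"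
    unfolding p N_III_span[OF dim] by (simp add: norm_fun_III_def sy)
qed

lemma g_II_not_projectively_induced:
  fixes f :: "real \<Rightarrow> real"
  assumes f: "profile_II n f" and n: "n > 0" and c: "0 < c" "c \<le> 1"
  shows "\<not> projectively_induced (M_II :: 'm::finite point_II set) atlas_II (scale_metric c (g_II f))"
proof -
  let ?C = "({x. param_II id id x \<in> (M_II :: 'm point_II set)}, param_II id id)"
  fix j0 :: 'm
  show ?thesis
  proof (rule stenzel_slice_not_projectively_induced[where C = ?C and i = "Inl j0" and \<phi> = "\<lambda>p. f (N_II p)"])
    show "?C \<in> atlas_II" unfolding atlas_II_def using bij_id by blast
    show "scale_metric c (g_II f) ?C x $ Inl j0 $ Inl j0
        = of_real c * kahler_metric (\<lambda>p. f (N_II p)) ?C x $ Inl j0 $ Inl j0" for x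
      by (simp add: scale_metric_def g_II_def) (simp add: scaleR_conv_of_real)
    show "(f has_real_derivative stenzel_slope 1 0 (1 / (2 * n)) x) (at x within {1..})" if "x \<ge> 1" for x
      using profile_II_slope[OF f n that] by simp
  qed (use c slice_II[of j0] in simp_all)
qed

lemma g_III_not_projectively_induced:
  fixes f :: "real \<Rightarrow> real"
  assumes f: "profile_III n f" and n: "n > 1" and c: "0 < c" "c \<le> 1"
  shows "\<not> projectively_induced (M_III :: 'm::finite point_III set) atlas_III (scale_metric c (g_III f))"
proof -
  let ?C = "({x. param_III id x \<in> (M_III :: 'm point_III set)}, param_III id)"
  fix j0 :: 'm
  have bB: "1 / (2 * (2 * real n)) * (2 * real n / (2 * real n + 1)) = 1 / (2 * (2 * real n + 1))"
    using n by (simp add: divide_simps)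
  show ?thesis
  proof (rule stenzel_slice_not_projectively_induced[where C = ?C and i = "Inl (j0, False)" and \<phi> = "\<lambda>p. f (N_III p)"])
    show "?C \<in> atlas_III" unfolding atlas_III_def using bij_id by blast
    show "scale_metric c (g_III f) ?C x $ Inl (j0, False) $ Inl (j0, False)
        = of_real c * kahler_metric (\<lambda>p. f (N_III p)) ?C x $ Inl (j0, False) $ Inl (j0, False)" for x
      by (simp add: scale_metric_def g_III_def) (simp add: scaleR_conv_of_real)
    show "(f has_real_derivative stenzel_slope (1 / (2 * real n + 1)) (2 * real n / (2 * real n + 1))
        (1 / (2 * (2 * real n))) x) (at x within {1..})" if "x \<ge> 1" for x
      using profile_III_slope[OF f _ that] n by (simp add: add.commute)
    show "1 / (2 * real n + 1) + 2 * real n / (2 * real n + 1) = 1"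
      by (simp flip: add_divide_distrib)
    show "1 / (2 * (2 * real n)) * (2 * real n / (2 * real n + 1)) \<le> 1 / 10"
      unfolding bB using n by (simp add: divide_simps)
    show "1 / (2 * (2 * real n)) * (2 * real n / (2 * real n + 1)) * (2 * real n / (2 * real n + 1))
      = 1 / (2 * (2 * real n)) * (2 * real n / (2 * real n + 1))
        * (1 - 2 * (1 / (2 * (2 * real n)) * (2 * real n / (2 * real n + 1))))"
      unfolding bB by (simp add: divide_simps)
  qed (use c slice_III[of j0] in simp_all)
qed

theorem theorem1:
  fixes n :: nat and f_II f_III :: "real \<Rightarrow> real"
  assumes "n > 1" and "CARD('m::finite) = n"
    and "profile_II n f_II" and "profile_III n f_III"
  shows "\<not> projectively_induced (M_II :: 'm point_II set) atlas_II (g_II f_II)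
    \<and> \<not> projectively_induced (M_III :: 'm point_III set) atlas_III (g_III f_III)
    \<and> (\<forall>c::real. 0 < c \<and> c \<le> 1 \<longrightarrow>
          \<not> projectively_induced (M_II :: 'm point_II set) atlas_II (scale_metric c (g_II f_II))
        \<and> \<not> projectively_induced (M_III :: 'm point_III set) atlas_III (scale_metric c (g_III f_III)))"
proof -
  have II: "\<not> projectively_induced (M_II :: 'm point_II set) atlas_II (scale_metric c (g_II f_II))"
    if "0 < c" "c \<le> 1" for c
    using g_II_not_projectively_induced assms that by (metis less_trans zero_less_one)
  have III: "\<not> projectively_induced (M_III :: 'm point_III set) atlas_III (scale_metric c (g_III f_III))"
    if "0 < c" "c \<le> 1" for c
    using g_III_not_projectively_induced assms that by blast
  have one: "scale_metric 1 g = g" for g :: "('p, 'k::finite) hermitian_metric"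
    by (simp add: scale_metric_def fun_eq_iff)
  show ?thesis using II III II[of 1] III[of 1] by (simp add: one)
qed

end
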